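(* Let $\alpha\ge1$ and let $f_\alpha\colon S^1\to S^1$, $S^1=[0,1)$, be the intermittent map $$f_\alpha(x)=\begin{cases}x(1+2^\alpha x^\alpha)&x<1/2,\\2x-1&x\ge1/2.\end{cases}$$ For Lebesgue almost every $x\in S^1$, $$\lim_{n\to\infty}\frac{\xi_n^{(1)}(x)}{\log_2n}=\frac1\alpha\qquad\text{and}\qquad\lim_{n\to\infty}\frac{\log\xi_n^{(0)}(x)}{\log n}=1.$$
   Context: Code $x\in S^1$ by the sequence $(\varepsilon_k(x))_{k\ge1}$, where $\varepsilon_k(x)=0$ if $f_\alpha^{k-1}(x)\in[0,1/2)$ and $\varepsilon_k(x)=1$ if $f_\alpha^{k-1}(x)\in[1/2,1)$. The dynamical run length function of digit $j\in\{0,1\}$ is $$\xi_n^{(j)}(x)=\max\{0\le k\le n:\ \exists\,0\le i\le n-k,\ \varepsilon_{i+1}(x)=\cdots=\varepsilon_{i+k}(x)=j\}.$$ *)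

theory Defs
  imports "HOL-Analysis.Analysis"
begin

text \<open>The circle is identified with the interval \<open>[0, 1)\<close>. The map and the coding below are
  total functions on the reals, but only their values on \<open>circle\<close> matter; \<open>intermittent_map_in_circle\<close>
  shows that the map preserves \<open>circle\<close>.\<close>

definition circle :: "real set" where
  "circle = {0..<1}"

definition intermittent_map :: "real \<Rightarrow> real \<Rightarrow> real" where
  "intermittent_map \<alpha> x =
     (if x < 1/2 then x * (1 + 2 powr \<alpha> * x powr \<alpha>) else 2 * x - 1)"

text \<open>Digits are indexed from \<open>k = 1\<close>; the value at \<open>k = 0\<close> is never used.\<close>

definition digit :: "real \<Rightarrow> nat \<Rightarrow> real \<Rightarrow> nat" where
  "digit \<alpha> k x = (if (intermittent_map \<alpha> ^^ (k - 1)) x \<in> {0..<1/2} then 0 else 1)"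

text \<open>The set below contains \<open>0\<close> and is bounded by \<open>n\<close>, so the maximum is well defined, and
  \<open>k \<le> n\<close> makes the natural-number subtraction \<open>n - k\<close> the true one.\<close>

definition run_length :: "real \<Rightarrow> nat \<Rightarrow> nat \<Rightarrow> real \<Rightarrow> nat" where
  "run_length \<alpha> j n x =
     Max {k. k \<le> n \<and> (\<exists>i\<le>n - k. \<forall>m\<in>{1..k}. digit \<alpha> (i + m) x = j)}"

lemma intermittent_map_in_circle:
  assumes "\<alpha> \<ge> 1" "x \<in> circle"
  shows "intermittent_map \<alpha> x \<in> circle"
proof (cases "x < 1/2")
  case True
  have x: "0 \<le> x" using assms by (simp add: circle_def)
  have "2 powr \<alpha> * x powr \<alpha> = (2 * x) powr \<alpha>"
    using x by (simp add: powr_mult)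
  also have "\<dots> \<le> 1"
    using x True assms by (intro powr_le1) auto
  finally have le: "2 powr \<alpha> * x powr \<alpha> \<le> 1" .
  have "x * (1 + 2 powr \<alpha> * x powr \<alpha>) \<le> x * 2"
    using x le by (intro mult_left_mono) auto
  with True x show ?thesis by (simp add: intermittent_map_def circle_def)
next
  case False
  with assms show ?thesis by (simp add: intermittent_map_def circle_def)
qed

end

theory Submission
  imports Defs "HOL-Real_Asymp.Real_Asymp"
begin

text \<open>
  Cut the digit sequence of \<open>x\<close> after each digit \<open>1\<close>: it becomes \<open>0\<^sup>a\<close>\<open>1\<close> \<open>0\<^sup>b\<close>\<open>1\<close> \<open>0\<^sup>c\<close>\<open>1 \<dots>\<close>,
  and the excursion lengths \<open>a, b, c, \<dots>\<close> (\<open>exc i x\<close>) are the symbolic dynamics of the jump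
  transformation \<open>jump\<close>, which applies \<open>f\<close> until just after the first visit to \<open>[1/2, 1)\<close>. Near the
  neutral fixed point \<open>0\<close> the map \<open>f\<close> is slow, but \<open>jump\<close> is a full-branch map, uniformly expanding, and its
  iterated inverse branches \<open>branch w\<close> have uniformly bounded distortion (\<open>branch_distortion\<close>). So the
  excursion lengths are independent up to a constant factor: if \<open>A\<close> is an event about the first \<open>n\<close>
  excursions, then the probability that \<open>A\<close> holds and \<open>jump\<^sup>n x\<close> lies in an interval \<open>J\<close> is
  comparable to \<open>\<bar>J\<bar> P(A)\<close> (\<open>measure_determined_le\<close>, \<open>measure_determined_ge\<close>).

  Two families of intervals matter. An excursion has length at least \<open>m\<close> iff it starts in \<open>[0, z m)\<close>,
  where \<open>z m\<close> is the \<open>m\<close>-th preimage of \<open>1\<close> under the left branch and is of order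
  \<open>m\<close> to the power \<open>-1/\<alpha>\<close> (\<open>z_upper\<close>, \<open>z_lower\<close>). A block of \<open>k\<close> excursions of length \<open>0\<close>, i.e. a
  block of \<open>k\<close> digits \<open>1\<close>, occurs iff it starts in \<open>[1 - 2\<^sup>-\<^sup>k, 1)\<close>. Borel-Cantelli arguments along a
  dyadic scale \<open>j\<close>, with \<open>stage j\<close> about \<open>j\<close> times \<open>2\<close> to the power \<open>j/\<alpha>\<close>, then give almost surely:
  some excursion among the first \<open>stage j\<close> has length at least \<open>2\<^sup>j\<close> (\<open>long_excursion_early\<close>); some
  block of \<open>j\<close> zero excursions occurs among the first \<open>j\<^sup>2\<close>\<open>2\<^sup>j\<close> (\<open>long_zero_run_early\<close>); no block of
  \<open>j/\<alpha> + O(log j)\<close> zero excursions starts within the first \<open>stage j\<close> (\<open>no_longer_zero_run\<close>); and the first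
  \<open>k\<close> excursions take time at most a constant times \<open>k\<close> to the power \<open>\<beta>\<close>, for every \<open>\<beta> > \<alpha>\<close> (\<open>elapsed_growth\<close>).

  The last fact holds because the excursion lengths have finite moments of every order below \<open>1/\<alpha>\<close>, although
  their mean is infinite. Together with the first it shows that up to time \<open>n\<close> there are about \<open>n\<close> to the
  power \<open>1/\<alpha>\<close> excursions, on a logarithmic scale, and that the longest of them has length \<open>n\<close> on that
  scale; this is the limit for the digit \<open>0\<close>. Among that many excursions the longest block of zero
  excursions has length about the binary logarithm of their number, i.e. \<open>(log n)/\<alpha>\<close>; this is the
  limit for the digit \<open>1\<close>.
\<close>

section \<open>Distortion of increasing maps\<close>

text \<open>Difference quotients over any two subintervals are compared, instead of derivatives at two points.
  The chain rule below is then a plain multiplication, and bounds for the relative lengths of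
  subintervals can be read off directly.\<close>
definition distortion_le :: "real \<Rightarrow> (real \<Rightarrow> real) \<Rightarrow> real \<Rightarrow> real \<Rightarrow> bool" where
  "distortion_le K \<phi> p s \<longleftrightarrow>
     (\<forall>q r q' r'. p \<le> q \<and> q < r \<and> r \<le> s \<and> p \<le> q' \<and> q' < r' \<and> r' \<le> s \<longrightarrow>
        (\<phi> r - \<phi> q) / (r - q) \<le> exp K * ((\<phi> r' - \<phi> q') / (r' - q')))"

lemma distortion_leI:
  assumes "\<And>q r q' r'. p \<le> q \<Longrightarrow> q < r \<Longrightarrow> r \<le> s \<Longrightarrow> p \<le> q' \<Longrightarrow> q' < r' \<Longrightarrow> r' \<le> s \<Longrightarrow>
        (\<phi> r - \<phi> q) / (r - q) \<le> exp K * ((\<phi> r' - \<phi> q') / (r' - q'))"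
  shows "distortion_le K \<phi> p s"
  using assms by (simp add: distortion_le_def)

lemma distortion_leD:
  assumes "distortion_le K \<phi> p s"
    "p \<le> q" "q < r" "r \<le> s" "p \<le> q'" "q' < r'" "r' \<le> s"
  shows "(\<phi> r - \<phi> q) / (r - q) \<le> exp K * ((\<phi> r' - \<phi> q') / (r' - q'))"
  using assms by (simp add: distortion_le_def)

text \<open>A difference quotient of \<open>\<psi> \<circ> \<phi>\<close> is the product of one of \<open>\<phi>\<close> and one of \<open>\<psi>\<close>, so the logarithmic
  distortions add up.\<close>
lemma distortion_le_compose:
  assumes \<phi>: "distortion_le K \<phi> p s" and \<psi>: "distortion_le K' \<psi> (\<phi> p) (\<phi> s)"
    and \<phi>_mono: "strict_mono_on {p..s} \<phi>" and \<psi>_mono: "strict_mono_on {\<phi> p..\<phi> s} \<psi>"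
  shows "distortion_le (K + K') (\<psi> \<circ> \<phi>) p s"
proof (rule distortion_leI)
  fix q r q' r' assume *: "p \<le> q" "q < r" "r \<le> s" "p \<le> q'" "q' < r'" "r' \<le> s"
  have le: "\<phi> x \<le> \<phi> y" if "p \<le> x" "x \<le> y" "y \<le> s" for x y
    using that strict_mono_onD[OF \<phi>_mono, of x y] by (cases "x = y") auto
  have less: "\<phi> q < \<phi> r" "\<phi> q' < \<phi> r'" using * strict_mono_onD[OF \<phi>_mono] by auto
  have rng: "\<phi> p \<le> \<phi> q" "\<phi> r \<le> \<phi> s" "\<phi> p \<le> \<phi> q'" "\<phi> r' \<le> \<phi> s" using * le by auto
  have "((\<psi> \<circ> \<phi>) r - (\<psi> \<circ> \<phi>) q) / (r - q)
      = (\<psi> (\<phi> r) - \<psi> (\<phi> q)) / (\<phi> r - \<phi> q) * ((\<phi> r - \<phi> q) / (r - q))"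
    using less by simp
  also have "\<dots> \<le> (exp K' * ((\<psi> (\<phi> r') - \<psi> (\<phi> q')) / (\<phi> r' - \<phi> q'))) *
                  (exp K * ((\<phi> r' - \<phi> q') / (r' - q')))"
  proof (intro mult_mono)
    show "(\<psi> (\<phi> r) - \<psi> (\<phi> q)) / (\<phi> r - \<phi> q)
        \<le> exp K' * ((\<psi> (\<phi> r') - \<psi> (\<phi> q')) / (\<phi> r' - \<phi> q'))"
      using distortion_leD[OF \<psi>] less rng by blast
    show "(\<phi> r - \<phi> q) / (r - q) \<le> exp K * ((\<phi> r' - \<phi> q') / (r' - q'))"
      using distortion_leD[OF \<phi>] * by blast
    have "\<psi> (\<phi> q') < \<psi> (\<phi> r')"
      using rng less by (intro strict_mono_onD[OF \<psi>_mono]) auto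
    then show "0 \<le> exp K' * ((\<psi> (\<phi> r') - \<psi> (\<phi> q')) / (\<phi> r' - \<phi> q'))"
      using less by simp
    show "0 \<le> (\<phi> r - \<phi> q) / (r - q)" using less * by simp
  qed
  also have "\<dots> = exp (K + K') * (((\<psi> \<circ> \<phi>) r' - (\<psi> \<circ> \<phi>) q') / (r' - q'))"
    using less by (simp add: exp_add)
  finally show "((\<psi> \<circ> \<phi>) r - (\<psi> \<circ> \<phi>) q) / (r - q)
     \<le> exp (K + K') * (((\<psi> \<circ> \<phi>) r' - (\<psi> \<circ> \<phi>) q') / (r' - q'))" .
qed

lemma distortion_le_mono:
  assumes "distortion_le K \<phi> p s" "K \<le> K'" "strict_mono_on {p..s} \<phi>"
  shows "distortion_le K' \<phi> p s"
proof (rule distortion_leI)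
  fix q r q' r' assume *: "p \<le> q" "q < r" "r \<le> s" "p \<le> q'" "q' < r'" "r' \<le> s"
  have "\<phi> q' < \<phi> r'" using * by (intro strict_mono_onD[OF assms(3)]) auto
  then have "exp K * ((\<phi> r' - \<phi> q') / (r' - q')) \<le> exp K' * ((\<phi> r' - \<phi> q') / (r' - q'))"
    using assms(2) * by (intro mult_right_mono) auto
  with distortion_leD[OF assms(1) *]
  show "(\<phi> r - \<phi> q) / (r - q) \<le> exp K' * ((\<phi> r' - \<phi> q') / (r' - q'))" by linarith
qed

section \<open>Positions of runs\<close>

text \<open>Positions in the digit sequence are counted from \<open>0\<close> here, so that the digit at position \<open>p\<close> describes
  the \<open>p\<close>-th iterate; hence the successor in the index of \<open>digit\<close>.\<close>
lemma run_length_ge: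
  assumes "i + k \<le> n" "\<And>m. m < k \<Longrightarrow> digit \<alpha> (Suc (i + m)) x = j"
  shows "k \<le> run_length \<alpha> j n x"
  unfolding run_length_def
proof (rule Max_ge)
  have "\<forall>m\<in>{1..k}. digit \<alpha> (i + m) x = j"
  proof
    fix m assume "m \<in> {1..k}"
    then show "digit \<alpha> (i + m) x = j" using assms(2)[of "m - 1"] by (cases m) auto
  qed
  moreover have "i \<le> n - k" "k \<le> n" using assms(1) by auto
  ultimately show "k \<in> {k. k \<le> n \<and> (\<exists>i\<le>n - k. \<forall>m\<in>{1..k}. digit \<alpha> (i + m) x = j)}" by blast
qed simp

lemma run_length_attained:
  obtains i where "i + run_length \<alpha> j n x \<le> n"
    "\<And>m. m < run_length \<alpha> j n x \<Longrightarrow> digit \<alpha> (Suc (i + m)) x = j"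
proof -
  have "run_length \<alpha> j n x \<in> {k. k \<le> n \<and> (\<exists>i\<le>n - k. \<forall>m\<in>{1..k}. digit \<alpha> (i + m) x = j)}"
    unfolding run_length_def by (rule Max_in) (auto intro!: exI[of _ 0])
  then obtain i where i: "run_length \<alpha> j n x \<le> n" "i \<le> n - run_length \<alpha> j n x"
    "\<forall>m\<in>{1..run_length \<alpha> j n x}. digit \<alpha> (i + m) x = j" by blast
  show ?thesis
  proof (rule that)
    show "i + run_length \<alpha> j n x \<le> n" using i by simp
    show "digit \<alpha> (Suc (i + m)) x = j" if "m < run_length \<alpha> j n x" for m
      using i(3)[rule_format, of "Suc m"] that by simp
  qed
qed

lemma run_length_le: "run_length \<alpha> j n x \<le> n"
  by (rule run_length_attained[of \<alpha> j n x]) simp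

section \<open>The left branch and its inverse\<close>

text \<open>The left branch, extended to all \<open>x \<ge> 0\<close> so that it is continuous at \<open>1/2\<close> and has value \<open>1\<close> there.\<close>
definition left_map :: "real \<Rightarrow> real \<Rightarrow> real" where
  "left_map \<alpha> x = x * (1 + (2 * x) powr \<alpha>)"

locale intermittent =
  fixes \<alpha> :: real
  assumes alpha_ge_1: "\<alpha> \<ge> 1"
begin

abbreviation f :: "real \<Rightarrow> real" where "f \<equiv> intermittent_map \<alpha>"

text \<open>The derivative of the left branch.\<close>
definition slope :: "real \<Rightarrow> real" where
  "slope x = 1 + (1 + \<alpha>) * (2 * x) powr \<alpha>"

lemma f_left: "0 \<le> x \<Longrightarrow> x < 1/2 \<Longrightarrow> f x = left_map \<alpha> x"
  by (simp add: intermittent_map_def left_map_def powr_mult)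

lemma f_right: "1/2 \<le> x \<Longrightarrow> f x = 2 * x - 1"
  by (simp add: intermittent_map_def)

lemma left_map_deriv:
  assumes "0 < x"
  shows "(left_map \<alpha> has_real_derivative slope x) (at x)"
proof -
  have e: "x * (2 * x) powr (\<alpha> - 1) * 2 = (2 * x) powr \<alpha>"
    using assms by (simp add: powr_diff)
  have "(left_map \<alpha> has_real_derivative
      (1 + (2 * x) powr \<alpha>) + x * (\<alpha> * (2 * x) powr (\<alpha> - 1) * 2)) (at x)"
    unfolding left_map_def [abs_def]
    by (rule derivative_eq_intros refl | use assms in simp)+
  moreover have "(1 + (2 * x) powr \<alpha>) + x * (\<alpha> * (2 * x) powr (\<alpha> - 1) * 2) = slope x"
    using e by (simp add: slope_def algebra_simps)
  ultimately show ?thesis by simp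
qed

lemma left_map_cont: "continuous_on {0..} (left_map \<alpha>)"
  unfolding left_map_def [abs_def]
  using alpha_ge_1 by (intro continuous_intros continuous_on_powr') auto

lemma left_map_mvt:
  assumes "0 \<le> p" "p < s"
  obtains \<xi> where "p < \<xi>" "\<xi> < s" "left_map \<alpha> s - left_map \<alpha> p = slope \<xi> * (s - p)"
proof -
  have "\<exists>l z. p < z \<and> z < s \<and> DERIV (left_map \<alpha>) z :> l \<and> left_map \<alpha> s - left_map \<alpha> p = (s - p) * l"
  proof (rule MVT)
    show "continuous_on {p..s} (left_map \<alpha>)"
      using left_map_cont by (rule continuous_on_subset) (use assms in auto)
    show "\<And>x. p < x \<Longrightarrow> x < s \<Longrightarrow> left_map \<alpha> differentiable at x"
      using left_map_deriv assms by (meson le_less_trans real_differentiable_def)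
  qed (use assms in auto)
  then obtain l \<xi> where \<xi>: "p < \<xi>" "\<xi> < s" "DERIV (left_map \<alpha>) \<xi> :> l"
      "left_map \<alpha> s - left_map \<alpha> p = (s - p) * l" by blast
  moreover have "l = slope \<xi>"
    using \<xi> assms left_map_deriv[of \<xi>] DERIV_unique by force
  ultimately show ?thesis using that by (simp add: mult.commute)
qed

lemma slope_ge_1: "slope x \<ge> 1"
  using alpha_ge_1 by (simp add: slope_def)

lemma slope_mono: "0 \<le> x \<Longrightarrow> x \<le> y \<Longrightarrow> slope x \<le> slope y"
  using alpha_ge_1 by (simp add: slope_def powr_mono2 mult_left_mono)

definition lip :: real where "lip = 2 * \<alpha> * (1 + \<alpha>)"

lemma lip_pos: "lip > 0"
  using alpha_ge_1 by (simp add: lip_def)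

text \<open>The exponent \<open>\<alpha> - 1\<close> of the second derivative is nonnegative, so the second derivative is bounded up to
  the neutral fixed point. This is where \<open>\<alpha> \<ge> 1\<close> makes the distortion estimate simple.\<close>
lemma slope_lipschitz:
  assumes "0 \<le> p" "p \<le> s" "s \<le> 1/2"
  shows "slope s - slope p \<le> lip * (s - p)"
proof (cases "p = s")
  case False
  have "\<exists>l z. p < z \<and> z < s \<and> DERIV (\<lambda>x. (2 * x) powr \<alpha>) z :> l \<and>
     (2 * s) powr \<alpha> - (2 * p) powr \<alpha> = (s - p) * l"
  proof (rule MVT)
    show "continuous_on {p..s} (\<lambda>x. (2 * x) powr \<alpha>)"
      using assms alpha_ge_1 by (intro continuous_intros continuous_on_powr') auto
    show "(\<lambda>x. (2 * x) powr \<alpha>) differentiable (at x)" if "p < x" "x < s" for x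
    proof -
      have "((\<lambda>x. (2 * x) powr \<alpha>) has_real_derivative (\<alpha> * (2 * x) powr (\<alpha> - 1) * 2)) (at x)"
        by (rule derivative_eq_intros refl | use assms that in simp)+
      then show ?thesis using real_differentiable_def by blast
    qed
  qed (use assms False in auto)
  then obtain l \<xi> where \<xi>: "p < \<xi>" "\<xi> < s" "DERIV (\<lambda>x. (2 * x) powr \<alpha>) \<xi> :> l"
      "(2 * s) powr \<alpha> - (2 * p) powr \<alpha> = (s - p) * l" by blast
  have "((\<lambda>x. (2 * x) powr \<alpha>) has_real_derivative (\<alpha> * (2 * \<xi>) powr (\<alpha> - 1) * 2)) (at \<xi>)"
    by (rule derivative_eq_intros refl | use assms \<xi> in simp)+
  then have l: "l = \<alpha> * (2 * \<xi>) powr (\<alpha> - 1) * 2"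
    using \<xi> DERIV_unique by blast
  have "(2 * \<xi>) powr (\<alpha> - 1) \<le> 1"
    using \<xi> assms alpha_ge_1 by (intro powr_le1) auto
  then have "l \<le> 2 * \<alpha>" using alpha_ge_1 by (simp add: l)
  then have "(2 * s) powr \<alpha> - (2 * p) powr \<alpha> \<le> (s - p) * (2 * \<alpha>)"
    using \<xi> by (simp add: mult_left_mono)
  then have "(1 + \<alpha>) * ((2 * s) powr \<alpha> - (2 * p) powr \<alpha>) \<le> (1 + \<alpha>) * ((s - p) * (2 * \<alpha>))"
    using alpha_ge_1 by (intro mult_left_mono) auto
  then show ?thesis by (simp add: slope_def lip_def algebra_simps)
qed simp

lemma left_map_strict_mono: "0 \<le> p \<Longrightarrow> p < s \<Longrightarrow> left_map \<alpha> p < left_map \<alpha> s"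
proof -
  assume "0 \<le> p" "p < s"
  then obtain \<xi> where "left_map \<alpha> s - left_map \<alpha> p = slope \<xi> * (s - p)"
    using left_map_mvt by metis
  moreover have "slope \<xi> * (s - p) > 0"
    using slope_ge_1[of \<xi>] \<open>p < s\<close> by simp
  ultimately show ?thesis by simp
qed

lemma left_map_ends [simp]: "left_map \<alpha> 0 = 0" "left_map \<alpha> (1/2) = 1"
  by (simp_all add: left_map_def)

text \<open>The inverse of the left branch, meaningful on \<open>[0, 1]\<close>.\<close>
definition g :: "real \<Rightarrow> real" where
  "g y = (THE x. 0 \<le> x \<and> x \<le> 1/2 \<and> left_map \<alpha> x = y)"

lemma g_props:
  assumes "0 \<le> y" "y \<le> 1"
  shows "0 \<le> g y" "g y \<le> 1/2" "left_map \<alpha> (g y) = y"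
proof -
  have "\<exists>x\<ge>0. x \<le> 1/2 \<and> left_map \<alpha> x = y"
    by (rule IVT') (use assms left_map_cont in \<open>auto intro: continuous_on_subset\<close>)
  then have "\<exists>!x. 0 \<le> x \<and> x \<le> 1/2 \<and> left_map \<alpha> x = y"
    using left_map_strict_mono by (metis less_irrefl linorder_neqE_linordered_idom)
  from theI'[OF this] show "0 \<le> g y" "g y \<le> 1/2" "left_map \<alpha> (g y) = y"
    by (auto simp: g_def)
qed

lemma left_map_le_iff:
  "0 \<le> p \<Longrightarrow> 0 \<le> s \<Longrightarrow> left_map \<alpha> p \<le> left_map \<alpha> s \<longleftrightarrow> p \<le> s"
  by (metis left_map_strict_mono leD linorder_le_less_linear order_less_imp_le order.refl order_le_less)

lemma left_map_less_iff:
  "0 \<le> p \<Longrightarrow> 0 \<le> s \<Longrightarrow> left_map \<alpha> p < left_map \<alpha> s \<longleftrightarrow> p < s"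
  using left_map_le_iff[of s p] by linarith

lemma g_left_map:
  assumes "0 \<le> x" "x \<le> 1/2"
  shows "g (left_map \<alpha> x) = x"
proof -
  have "0 \<le> left_map \<alpha> x" "left_map \<alpha> x \<le> 1"
    using assms left_map_le_iff[of 0 x] left_map_le_iff[of x "1/2"] by auto
  from g_props[OF this] show ?thesis
    using assms left_map_le_iff by (metis order.antisym order.refl)
qed

lemma g_less_iff: "u \<in> {0..1} \<Longrightarrow> v \<in> {0..1} \<Longrightarrow> g u < g v \<longleftrightarrow> u < v"
  using left_map_less_iff[of "g u" "g v"] g_props[of u] g_props[of v] by auto

lemma g_le_iff: "u \<in> {0..1} \<Longrightarrow> v \<in> {0..1} \<Longrightarrow> g u \<le> g v \<longleftrightarrow> u \<le> v"
  using g_less_iff[of v u] by force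

lemma g_ends [simp]: "g 0 = 0" "g 1 = 1/2"
  using g_left_map[of 0] g_left_map[of "1/2"] by simp_all

lemma g_mvt:
  assumes "0 \<le> u" "u < v" "v \<le> 1"
  obtains \<xi> where "g u < \<xi>" "\<xi> < g v" "v - u = slope \<xi> * (g v - g u)"
proof -
  have "0 \<le> g u" "g u < g v" using assms g_props[of u] g_less_iff by auto
  from left_map_mvt[OF this] g_props[of u] g_props[of v] assms that show ?thesis
    by (smt (verit))
qed

lemma g_contracts:
  assumes "0 \<le> u" "u \<le> v" "v \<le> 1"
  shows "g v - g u \<le> v - u"
proof (cases "u = v")
  case False
  then obtain \<xi> where \<xi>: "g u < \<xi>" "\<xi> < g v" "v - u = slope \<xi> * (g v - g u)"
    using g_mvt assms by (metis order_le_less)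
  then show ?thesis using slope_ge_1[of \<xi>] mult_right_mono[of 1 "slope \<xi>" "g v - g u"] by simp
qed simp

text \<open>Concavity of \<open>g\<close>, in the multiplicative form that survives iteration: a secant further to the right
  shrinks by a larger factor.\<close>
lemma g_slopes_decrease:
  assumes "0 \<le> a" "a < b" "b \<le> u" "u < v" "v \<le> 1"
  shows "(g v - g u) / (g b - g a) \<le> (v - u) / (b - a)"
proof -
  obtain \<xi> where \<xi>: "g u < \<xi>" "\<xi> < g v" "v - u = slope \<xi> * (g v - g u)"
    using g_mvt[of u v] assms by auto
  obtain \<zeta> where \<zeta>: "g a < \<zeta>" "\<zeta> < g b" "b - a = slope \<zeta> * (g b - g a)"
    using g_mvt[of a b] assms by auto
  have "\<zeta> \<le> \<xi>" using \<xi> \<zeta> assms g_le_iff[of b u] by auto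
  then have "slope \<zeta> \<le> slope \<xi>" using \<zeta> g_props[of a] assms by (intro slope_mono) auto
  moreover have "slope \<zeta> \<ge> 1" by (rule slope_ge_1)
  ultimately have "1 \<le> slope \<xi> / slope \<zeta>" by simp
  then have "1 * ((g v - g u) / (g b - g a)) \<le> slope \<xi> / slope \<zeta> * ((g v - g u) / (g b - g a))"
    using \<xi> \<zeta> by (intro mult_right_mono) auto
  then show ?thesis using \<xi> \<zeta> by simp
qed

section \<open>Bounded distortion\<close>

text \<open>Two difference quotients of \<open>g\<close> are reciprocals of slopes at two points of \<open>[g p, g s]\<close>. Slopes are at
  least \<open>1\<close> and Lipschitz, so their ratio is at most \<open>1 + lip * (g s - g p)\<close>.\<close>
lemma g_distortion:
  assumes "0 \<le> p" "p < s" "s \<le> 1"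
  shows "distortion_le (lip * (g s - g p)) g p s"
proof (rule distortion_leI)
  fix q r q' r' assume *: "p \<le> q" "q < r" "r \<le> s" "p \<le> q'" "q' < r'" "r' \<le> s"
  obtain \<xi> where \<xi>: "g q < \<xi>" "\<xi> < g r" "r - q = slope \<xi> * (g r - g q)"
    using g_mvt[of q r] assms * by auto
  obtain \<zeta> where \<zeta>: "g q' < \<zeta>" "\<zeta> < g r'" "r' - q' = slope \<zeta> * (g r' - g q')"
    using g_mvt[of q' r'] assms * by auto
  have b: "0 \<le> g p" "g p \<le> g q" "g p \<le> g q'" "g r \<le> g s" "g r' \<le> g s" "g s \<le> 1/2"
    using g_props[of p] g_props[of s] g_le_iff assms * by auto
  have pos: "slope \<xi> > 0" "slope \<zeta> > 0" using slope_ge_1[of \<xi>] slope_ge_1[of \<zeta>] by auto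
  have "slope \<zeta> \<le> slope (g s)" using \<zeta> b by (intro slope_mono) auto
  also have "\<dots> \<le> slope (g p) + lip * (g s - g p)"
    using slope_lipschitz[of "g p" "g s"] \<xi> b by auto
  also have "\<dots> \<le> slope (g p) + lip * (g s - g p) * slope (g p)"
    using slope_ge_1[of "g p"] lip_pos \<xi> b
    by (intro add_left_mono mult_left_mono[of 1, simplified]) auto
  also have "\<dots> = (1 + lip * (g s - g p)) * slope (g p)" by (simp add: algebra_simps)
  also have "\<dots> \<le> exp (lip * (g s - g p)) * slope \<xi>"
    using slope_ge_1[of "g p"] \<xi> b by (intro mult_mono exp_ge_add_one_self slope_mono) auto
  finally have "slope \<zeta> \<le> exp (lip * (g s - g p)) * slope \<xi>" .
  then have "1 / slope \<xi> \<le> exp (lip * (g s - g p)) * (1 / slope \<zeta>)"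
    using pos by (simp add: divide_simps mult.commute)
  then show "(g r - g q) / (r - q) \<le> exp (lip * (g s - g p)) * ((g r' - g q') / (r' - q'))"
    unfolding \<xi>(3) \<zeta>(3) using \<xi>(1,2) \<zeta>(1,2) pos by simp
qed

lemma g_pow_range: "y \<in> {0..1} \<Longrightarrow> (g ^^ n) y \<in> {0..1}"
  by (induction n) (use g_props in \<open>fastforce+\<close>)

lemma g_pow_less: "u \<in> {0..1} \<Longrightarrow> v \<in> {0..1} \<Longrightarrow> u < v \<Longrightarrow> (g ^^ n) u < (g ^^ n) v"
  by (induction n) (use g_less_iff g_pow_range in auto)

lemma g_pow_le: "u \<in> {0..1} \<Longrightarrow> v \<in> {0..1} \<Longrightarrow> u \<le> v \<Longrightarrow> (g ^^ n) u \<le> (g ^^ n) v"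
  using g_pow_less[of u v n] by (cases "u = v") auto

lemma g_pow_slopes_decrease:
  assumes "0 \<le> a" "a < b" "b \<le> u" "u < v" "v \<le> 1"
  shows "((g ^^ n) v - (g ^^ n) u) / ((g ^^ n) b - (g ^^ n) a) \<le> (v - u) / (b - a)"
proof (induction n)
  case (Suc n)
  have "((g ^^ Suc n) v - (g ^^ Suc n) u) / ((g ^^ Suc n) b - (g ^^ Suc n) a)
      \<le> ((g ^^ n) v - (g ^^ n) u) / ((g ^^ n) b - (g ^^ n) a)"
    using g_slopes_decrease[of "(g ^^ n) a" "(g ^^ n) b" "(g ^^ n) u" "(g ^^ n) v"]
      g_pow_less[of a b n] g_pow_less[of u v n] g_pow_le[of b u n] assms
      g_pow_range[of a n] g_pow_range[of v n] by auto
  with Suc show ?case by linarith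
qed simp

text \<open>The points with \<open>z (Suc m) \<le> x < z m\<close> are those which spend exactly \<open>m\<close> steps in \<open>[0, 1/2)\<close> before
  they enter \<open>[1/2, 1)\<close>.\<close>
definition z :: "nat \<Rightarrow> real" where "z m = (g ^^ m) 1"

lemma z_0 [simp]: "z 0 = 1" and z_1 [simp]: "z (Suc 0) = 1/2" and z_Suc: "z (Suc m) = g (z m)"
  by (simp_all add: z_def)

lemma g_pow_z: "(g ^^ n) (z m) = z (n + m)"
  by (simp add: z_def funpow_add)

lemma z_range: "z m \<in> {0..1}" unfolding z_def by (rule g_pow_range) simp

lemma z_less_Suc: "z (Suc m) < z m"
  using g_pow_less[of "1/2" 1 m] g_pow_z[of m 1] by (simp add: z_def)

lemma z_pos: "0 < z m"
  using z_less_Suc[of m] z_range[of "Suc m"] by auto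

text \<open>The reciprocal length of the gap \<open>[z 2, 1/2]\<close>, the room to the left of \<open>[1/2, 1]\<close> that controls distortion there.\<close>
definition room :: real where "room = 1 / (1/2 - z 2)"

lemma room_pos: "room > 0"
  using z_less_Suc[of 1] by (simp add: room_def numeral_2_eq_2)

text \<open>The key to bounded distortion in spite of the neutral fixed point: the images of \<open>[u, v]\<close> under the
  iterates of \<open>g\<close> have summable lengths. By concavity the image under an iterate is at most a fixed multiple
  of \<open>v - u\<close> times the image of the gap \<open>[z 2, 1/2]\<close> under the same iterate. The images of the gap are
  adjacent intervals inside \<open>[0, 1]\<close>, so their lengths telescope.\<close>
lemma g_pow_sum_le:
  assumes "1/2 \<le> u" "u \<le> v" "v \<le> 1"
  shows "(\<Sum>j<n. (g ^^ Suc j) v - (g ^^ Suc j) u) \<le> room * (v - u)"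
proof (cases "u = v")
  case False
  have z2: "z 2 < 1/2" "0 < z 2" using z_less_Suc[of 1] z_pos by (simp_all add: numeral_2_eq_2)
  \<comment> \<open>The gap \<open>[z 2, 1/2]\<close> lies to the left of \<open>[u, v]\<close>, as the monotonicity of slopes requires.\<close>
  have each: "(g ^^ Suc j) v - (g ^^ Suc j) u \<le> (v - u) * room * (z (j + 2) - z (j + 3))" for j
  proof -
    have e: "(g ^^ Suc j) (1/2) = z (j + 2)" "(g ^^ Suc j) (z 2) = z (j + 3)"
      using g_pow_z[of "Suc j" 1] g_pow_z[of "Suc j" 2] by (simp_all add: numeral_2_eq_2 numeral_3_eq_3)
    have "z (j + 2) - z (j + 3) > 0" using z_less_Suc[of "j + 2"] by (simp add: numeral_3_eq_3 numeral_2_eq_2)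
    moreover have "((g ^^ Suc j) v - (g ^^ Suc j) u) / (z (j + 2) - z (j + 3)) \<le> (v - u) * room"
      using g_pow_slopes_decrease[of "z 2" "1/2" u v "Suc j"] z2 assms False
      unfolding e room_def by auto
    ultimately show ?thesis by (simp add: pos_divide_le_eq)
  qed
  have "(\<Sum>j<n. (g ^^ Suc j) v - (g ^^ Suc j) u) \<le> (\<Sum>j<n. (v - u) * room * (z (j + 2) - z (j + 3)))"
    by (rule sum_mono) (rule each)
  also have "\<dots> = (v - u) * room * (\<Sum>j<n. z (j + 2) - z (Suc j + 2))"
    by (simp add: sum_distrib_left numeral_3_eq_3 numeral_2_eq_2)
  also have "(\<Sum>j<n. z (j + 2) - z (Suc j + 2)) = z 2 - z (n + 2)"
    using sum_lessThan_telescope'[of "\<lambda>j. z (j + 2)" n]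
    by (simp add: numeral_2_eq_2)
  also have "(v - u) * room * (z 2 - z (n + 2)) \<le> (v - u) * room * 1"
    using assms room_pos z2 z_pos[of "n + 2"] by (intro mult_left_mono) auto
  finally show ?thesis by (simp add: mult.commute)
qed simp

lemma g_pow_strict_mono: "0 \<le> p \<Longrightarrow> s \<le> 1 \<Longrightarrow> strict_mono_on {p..s} (g ^^ n)"
  by (intro strict_mono_onI g_pow_less) auto

lemma g_strict_mono: "0 \<le> p \<Longrightarrow> s \<le> 1 \<Longrightarrow> strict_mono_on {p..s} g"
  using g_pow_strict_mono[of p s 1] by simp

lemma g_pow_distortion:
  assumes "1/2 \<le> p" "p < s" "s \<le> 1"
  shows "distortion_le (lip * room * (s - p)) (g ^^ n) p s"
proof -
  have "distortion_le (lip * (\<Sum>j<n. (g ^^ Suc j) s - (g ^^ Suc j) p)) (g ^^ n) p s"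
  proof (induction n)
    case 0 show ?case by (rule distortion_leI) simp
  next
    case (Suc n)
    have "distortion_le (lip * (\<Sum>j<n. (g ^^ Suc j) s - (g ^^ Suc j) p)
        + lip * (g ((g ^^ n) s) - g ((g ^^ n) p))) (g \<circ> (g ^^ n)) p s"
    proof (rule distortion_le_compose[OF Suc])
      have "(g ^^ n) p \<in> {0..1}" "(g ^^ n) s \<in> {0..1}" "(g ^^ n) p < (g ^^ n) s"
        using assms g_pow_range[of p n] g_pow_range[of s n] g_pow_less[of p s n] by auto
      then show "distortion_le (lip * (g ((g ^^ n) s) - g ((g ^^ n) p))) g ((g ^^ n) p) ((g ^^ n) s)"
        and "strict_mono_on {(g ^^ n) p..(g ^^ n) s} g"
        by (auto intro: g_distortion g_strict_mono)
      show "strict_mono_on {p..s} (g ^^ n)" using assms by (intro g_pow_strict_mono) auto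
    qed
    then show ?case by (simp add: distrib_left comp_def)
  qed
  moreover have "lip * (\<Sum>j<n. (g ^^ Suc j) s - (g ^^ Suc j) p) \<le> lip * room * (s - p)"
    using g_pow_sum_le[of p s n] assms lip_pos by (simp add: mult_left_mono)
  ultimately show ?thesis
    by (rule distortion_le_mono) (use assms in \<open>simp add: g_pow_strict_mono\<close>)
qed

text \<open>The inverse branch of \<open>jump\<close> along which the orbit shows \<open>a\<close> digits \<open>0\<close> and then one digit \<open>1\<close>.\<close>
definition branch1 :: "nat \<Rightarrow> real \<Rightarrow> real" where
  "branch1 a y = (g ^^ a) ((y + 1) / 2)"

fun branch :: "nat list \<Rightarrow> real \<Rightarrow> real" where
  "branch [] y = y"
| "branch (a # w) y = branch1 a (branch w y)"

lemma branch1_range: "y \<in> {0..1} \<Longrightarrow> branch1 a y \<in> {0..1}"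
  unfolding branch1_def by (rule g_pow_range) auto

lemma branch_range: "y \<in> {0..1} \<Longrightarrow> branch w y \<in> {0..1}"
  by (induction w) (use branch1_range in auto)

lemma branch1_less: "u \<in> {0..1} \<Longrightarrow> v \<in> {0..1} \<Longrightarrow> u < v \<Longrightarrow> branch1 a u < branch1 a v"
  unfolding branch1_def by (rule g_pow_less) auto

lemma branch_less: "u \<in> {0..1} \<Longrightarrow> v \<in> {0..1} \<Longrightarrow> u < v \<Longrightarrow> branch w u < branch w v"
  by (induction w) (use branch_range branch1_less in auto)

lemma branch1_strict_mono: "0 \<le> p \<Longrightarrow> s \<le> 1 \<Longrightarrow> strict_mono_on {p..s} (branch1 a)"
  by (intro strict_mono_onI branch1_less) auto

lemma branch_strict_mono: "0 \<le> p \<Longrightarrow> s \<le> 1 \<Longrightarrow> strict_mono_on {p..s} (branch w)"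
  by (intro strict_mono_onI branch_less) auto

lemma g_pow_contracts:
  assumes "0 \<le> u" "u \<le> v" "v \<le> 1"
  shows "(g ^^ n) v - (g ^^ n) u \<le> v - u"
proof (induction n)
  case (Suc n)
  then show ?case
    using g_contracts[of "(g ^^ n) u" "(g ^^ n) v"] g_pow_range[of u n] g_pow_range[of v n]
      g_pow_le[of u v n] assms by auto
qed simp

lemma branch1_contracts:
  assumes "0 \<le> u" "u \<le> v" "v \<le> 1"
  shows "branch1 a v - branch1 a u \<le> (v - u) / 2"
proof -
  have "branch1 a v - branch1 a u \<le> (v + 1) / 2 - (u + 1) / 2"
    using g_pow_contracts[of "(u + 1) / 2" "(v + 1) / 2" a] assms unfolding branch1_def by simp
  also have "\<dots> = (v - u) / 2" by (simp add: field_simps)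
  finally show ?thesis .
qed

lemma branch_contracts: "branch w 1 - branch w 0 \<le> (1/2) ^ length w"
proof (induction w)
  case (Cons a w)
  have "branch1 a (branch w 1) - branch1 a (branch w 0) \<le> (branch w 1 - branch w 0) / 2"
    using branch_range[of 0 w] branch_range[of 1 w] branch_less[of 0 1 w]
    by (intro branch1_contracts) auto
  with Cons show ?case by simp
qed simp

lemma branch1_distortion:
  assumes "0 \<le> p" "p < s" "s \<le> 1"
  shows "distortion_le (lip * room * (s - p)) (branch1 a) p s"
proof -
  have half: "((r + 1) / 2 - (q + 1) / 2) / (r - q) = (1/2 :: real)" if "q < r" for q r
    using that by (simp add: field_simps)
  have "distortion_le 0 (\<lambda>y. (y + 1) / 2) p s"
    by (rule distortion_leI) (simp add: half)
  moreover have "strict_mono_on {p..s} (\<lambda>y :: real. (y + 1) / 2)"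
    by (rule strict_mono_onI) simp
  ultimately have "distortion_le (0 + lip * room * ((s + 1) / 2 - (p + 1) / 2)) ((g ^^ a) \<circ> (\<lambda>y. (y + 1) / 2)) p s"
    using assms by (intro distortion_le_compose g_pow_distortion g_pow_strict_mono) simp_all
  then have *: "distortion_le (lip * room * ((s + 1) / 2 - (p + 1) / 2)) (branch1 a) p s"
    by (simp add: branch1_def [abs_def] comp_def)
  have "(s + 1) / 2 - (p + 1) / 2 \<le> s - p" using assms by (simp add: field_simps)
  then have le: "lip * room * ((s + 1) / 2 - (p + 1) / 2) \<le> lip * room * (s - p)"
    using lip_pos room_pos by (intro mult_left_mono) auto
  show ?thesis
    using assms by (intro distortion_le_mono[OF * le] branch1_strict_mono) auto
qed

text \<open>Each inverse branch of \<open>jump\<close> halves lengths at least, so the distortions contributed by the letters of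
  \<open>w\<close> are dominated by a geometric series, independently of the length of \<open>w\<close>.\<close>
lemma branch_distortion: "distortion_le (2 * (lip * room)) (branch w) 0 1"
proof -
  have "distortion_le (lip * room * (\<Sum>j<length w. (1/2) ^ j)) (branch w) 0 1"
  proof (induction w)
    case Nil
    show ?case by (rule distortion_leI) simp
  next
    case (Cons a w)
    have b: "0 \<le> branch w 0" "branch w 0 < branch w 1" "branch w 1 \<le> 1"
      using branch_range[of 0 w] branch_range[of 1 w] branch_less[of 0 1 w] by auto
    have "lip * room * (branch w 1 - branch w 0) \<le> lip * room * (1/2) ^ length w"
      using branch_contracts[of w] lip_pos room_pos by (intro mult_left_mono) auto
    then have "distortion_le (lip * room * (1/2) ^ length w) (branch1 a) (branch w 0) (branch w 1)"
      using b by (intro distortion_le_mono[OF branch1_distortion _ branch1_strict_mono])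
    with Cons have "distortion_le (lip * room * (\<Sum>j<length w. (1/2) ^ j) + lip * room * (1/2) ^ length w)
        (branch1 a \<circ> branch w) 0 1"
      using b by (intro distortion_le_compose branch1_strict_mono branch_strict_mono) auto
    moreover have "branch (a # w) = branch1 a \<circ> branch w" by auto
    ultimately show ?case by (simp only: distrib_left sum.lessThan_Suc list.size add_0_right add_Suc_right)
  qed
  moreover have "(\<Sum>j<length w. (1/2) ^ j) \<le> (2 :: real)"
    by (simp add: sum_gp_strict)
  then have "lip * room * (\<Sum>j<length w. (1/2) ^ j) \<le> 2 * (lip * room)"
    using lip_pos room_pos by (simp add: mult.commute)
  ultimately show ?thesis
    by (rule distortion_le_mono) (simp add: branch_strict_mono)
qed

definition dist_const :: real where "dist_const = exp (2 * (lip * room))"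

lemma dist_const_ge_1: "dist_const \<ge> 1"
  using lip_pos room_pos by (simp add: dist_const_def)

text \<open>Taking one of the two subintervals to be \<open>[0, 1]\<close> turns bounded distortion into: an interval occupies in
  each cylinder, up to a constant, the same proportion as in the circle.\<close>
lemma branch_bounds:
  assumes "0 \<le> u" "u \<le> v" "v \<le> 1"
  shows "branch w v - branch w u \<le> dist_const * (v - u) * (branch w 1 - branch w 0)"
    and "(v - u) * (branch w 1 - branch w 0) / dist_const \<le> branch w v - branch w u"
proof -
  have len: "branch w 0 < branch w 1" by (rule branch_less) auto
  note d = distortion_leD[OF branch_distortion, folded dist_const_def]
  show "branch w v - branch w u \<le> dist_const * (v - u) * (branch w 1 - branch w 0)"
  proof (cases "u = v")
    case False
    then have "(branch w v - branch w u) / (v - u) \<le> dist_const * (branch w 1 - branch w 0)"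
      using d[of u v 0 1 w] assms by simp
    with False assms show ?thesis by (simp add: pos_divide_le_eq mult_ac)
  qed simp
  show "(v - u) * (branch w 1 - branch w 0) / dist_const \<le> branch w v - branch w u"
  proof (cases "u = v")
    case False
    then have "branch w 1 - branch w 0 \<le> dist_const * ((branch w v - branch w u) / (v - u))"
      using d[of 0 1 u v w] assms by simp
    also have "\<dots> = dist_const * (branch w v - branch w u) / (v - u)" by simp
    finally have "(branch w 1 - branch w 0) * (v - u) \<le> dist_const * (branch w v - branch w u)"
      using False assms by (simp add: pos_le_divide_eq)
    then show ?thesis using dist_const_ge_1 by (simp add: pos_divide_le_eq mult_ac)
  qed simp
qed

section \<open>The backward orbit of 1\<close>

lemma left_map_z: "left_map \<alpha> (z (Suc m)) = z m"
  using g_props(3)[of "z m"] z_range[of m] by (simp add: z_Suc)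

text \<open>The classical substitution \<open>z\<close> to the power \<open>-\<alpha>\<close>, which linearises the approach to a neutral fixed
  point: along the backward orbit of \<open>1\<close> the substituted variable grows by a bounded positive amount in each step.\<close>
lemma z_powr_step:
  shows "z m powr - \<alpha> + 1 \<le> z (Suc m) powr - \<alpha>"
    and "z (Suc m) powr - \<alpha> \<le> z m powr - \<alpha> + \<alpha> * 2 powr \<alpha>"
proof -
  define w where "w = z (Suc m)"
  \<comment> \<open>With this \<open>y\<close>, the relation \<open>left_map \<alpha> w = z m\<close> reads \<open>z m = w * (1 + y)\<close>.\<close>
  define y where "y = (2 * w) powr \<alpha>"
  have w: "0 < w" "w \<le> 1/2"
    using z_pos[of "Suc m"] g_props(2)[of "z m"] z_range[of m] by (auto simp: w_def z_Suc)
  have y: "0 < y" "y \<le> 1" using w alpha_ge_1 by (auto simp: y_def intro!: powr_le1)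
  have zm: "z m = w * (1 + y)"
    using left_map_z[of m] by (simp add: left_map_def w_def y_def)
  have q: "z m powr - \<alpha> = w powr - \<alpha> * (1 + y) powr - \<alpha>"
    using w y by (simp add: zm powr_mult)
  \<comment> \<open>This product does not depend on \<open>w\<close>, which is why the increments below are bounded.\<close>
  have wy: "w powr - \<alpha> * y = 2 powr \<alpha>"
    using w by (simp add: y_def powr_mult powr_minus field_simps)
  have "(1 + y) powr - \<alpha> \<le> (1 + y) powr - 1"
    using y alpha_ge_1 by (intro powr_mono) auto
  also have "\<dots> = 1 / (1 + y)" using y by (simp add: powr_minus divide_inverse)
  also have "\<dots> \<le> 1 - y / 2"
  proof -
    have "y * y \<le> y * 1" using y by (intro mult_left_mono) auto
    then show ?thesis using y by (simp add: divide_simps algebra_simps)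
  qed
  finally have "z m powr - \<alpha> \<le> w powr - \<alpha> * (1 - y / 2)"
    unfolding q by (intro mult_left_mono) auto
  also have "\<dots> = w powr - \<alpha> - 2 powr \<alpha> / 2"
    using wy by (simp add: algebra_simps)
  also have "\<dots> \<le> w powr - \<alpha> - 1"
    using powr_mono[of 1 \<alpha> 2] alpha_ge_1 by simp
  finally show "z m powr - \<alpha> + 1 \<le> z (Suc m) powr - \<alpha>" by (simp add: w_def)
  have "1 - \<alpha> * y \<le> 1 - \<alpha> * ln (1 + y)"
    using ln_add_one_self_le_self[of y] y alpha_ge_1 by (simp add: mult_left_mono)
  also have "\<dots> \<le> exp (- \<alpha> * ln (1 + y))"
    using exp_ge_add_one_self[of "- \<alpha> * ln (1 + y)"] by simp
  also have "\<dots> = (1 + y) powr - \<alpha>" using y by (simp add: powr_def)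
  finally have "w powr - \<alpha> * (1 - \<alpha> * y) \<le> z m powr - \<alpha>"
    unfolding q by (intro mult_left_mono) auto
  then have "w powr - \<alpha> - \<alpha> * (w powr - \<alpha> * y) \<le> z m powr - \<alpha>"
    by (simp add: algebra_simps)
  then show "z (Suc m) powr - \<alpha> \<le> z m powr - \<alpha> + \<alpha> * 2 powr \<alpha>"
    unfolding wy by (simp add: w_def)
qed

lemma z_upper: "z m \<le> (1 + real m) powr (- 1 / \<alpha>)"
proof -
  have "1 + real m \<le> z m powr - \<alpha>"
  proof (induction m)
    case (Suc m)
    then show ?case using z_powr_step(1)[of m] by simp
  qed simp
  then have "(z m powr - \<alpha>) powr (- 1 / \<alpha>) \<le> (1 + real m) powr (- 1 / \<alpha>)"
    using alpha_ge_1 by (intro powr_mono2') auto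
  then show ?thesis using alpha_ge_1 z_pos[of m] by (simp add: powr_powr)
qed

definition tail_const :: real where "tail_const = (\<alpha> * 2 powr \<alpha>) powr (- 1 / \<alpha>)"

lemma tail_const_pos: "tail_const > 0"
  using alpha_ge_1 by (simp add: tail_const_def)

lemma z_lower: "tail_const * (1 + real m) powr (- 1 / \<alpha>) \<le> z m"
proof -
  define C where "C = \<alpha> * 2 powr \<alpha>"
  have C: "1 \<le> C"
    using alpha_ge_1 mult_mono[of 1 \<alpha> 1 "2 powr \<alpha>"] by (simp add: C_def ge_one_powr_ge_zero)
  have "z m powr - \<alpha> \<le> C * (1 + real m)"
  proof (induction m)
    case (Suc m)
    then show ?case using z_powr_step(2)[of m] by (simp add: C_def algebra_simps)
  qed (use C in simp)
  then have "(C * (1 + real m)) powr (- 1 / \<alpha>) \<le> (z m powr - \<alpha>) powr (- 1 / \<alpha>)"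
    using alpha_ge_1 z_pos[of m] by (intro powr_mono2') auto
  then show ?thesis
    using alpha_ge_1 z_pos[of m] C by (simp add: powr_powr powr_mult tail_const_def C_def)
qed

lemma z_strict_antimono: "i < j \<Longrightarrow> z j < z i"
  by (induction rule: less_Suc_induct) (use z_less_Suc in auto)

lemma z_antimono: "i \<le> j \<Longrightarrow> z j \<le> z i"
  using z_strict_antimono[of i j] by (cases "i = j") auto

lemma z_tendsto_0: "z \<longlonglongrightarrow> 0"
proof (rule tendsto_sandwich[OF _ _ tendsto_const])
  show "\<forall>\<^sub>F m in sequentially. z m \<le> (1 + real m) powr (- 1 / \<alpha>)" using z_upper by simp
  show "(\<lambda>m. (1 + real m) powr (- 1 / \<alpha>)) \<longlonglongrightarrow> 0"
    using alpha_ge_1 by real_asymp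
  show "\<forall>\<^sub>F m in sequentially. 0 \<le> z m" using z_pos by (simp add: order_less_imp_le)
qed

section \<open>The jump transformation and its coding\<close>

text \<open>The number of steps before the first visit to \<open>[1/2, 1)\<close>, expressed by the fundamental intervals
  \<open>[z (Suc m), z m)\<close>.\<close>
definition entry_time :: "real \<Rightarrow> nat" where "entry_time x = (LEAST m. z (Suc m) \<le> x)"

definition jump :: "real \<Rightarrow> real" where "jump x = (f ^^ Suc (entry_time x)) x"

text \<open>The length of the \<open>i\<close>-th excursion to \<open>[0, 1/2)\<close>; it may be \<open>0\<close>.\<close>
definition exc :: "nat \<Rightarrow> real \<Rightarrow> nat" where "exc i x = entry_time ((jump ^^ i) x)"

lemma entry_eq_iff:
  assumes "0 < x" "x < 1"
  shows "entry_time x = a \<longleftrightarrow> z (Suc a) \<le> x \<and> x < z a"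
proof -
  obtain m where "z m < x"
    using order_tendstoD(2)[OF z_tendsto_0 assms(1)] eventually_happens'[of sequentially] by auto
  then have ex: "z (Suc m) \<le> x" using z_less_Suc[of m] by linarith
  have *: "z (Suc (entry_time x)) \<le> x" unfolding entry_time_def by (rule LeastI) (rule ex)
  have **: "x < z (entry_time x)"
  proof (cases "entry_time x")
    case (Suc k)
    then have "\<not> z (Suc k) \<le> x" unfolding entry_time_def by (intro not_less_Least) auto
    then show ?thesis using Suc by simp
  qed (use assms in simp)
  show ?thesis
  proof
    assume a: "z (Suc a) \<le> x \<and> x < z a"
    show "entry_time x = a"
    proof (rule linorder_cases[of "entry_time x" a])
      assume "entry_time x < a"
      then have "z a \<le> z (Suc (entry_time x))" by (intro z_antimono) auto
      then show ?thesis using a * by linarith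
    next
      assume "a < entry_time x"
      then have "z (entry_time x) \<le> z (Suc a)" by (intro z_antimono) auto
      then show ?thesis using a ** by linarith
    qed
  qed (use * ** in auto)
qed

lemma entry_ge_iff:
  assumes "0 < x" "x < 1"
  shows "m \<le> entry_time x \<longleftrightarrow> x < z m"
proof
  assume "m \<le> entry_time x"
  then show "x < z m" using entry_eq_iff[OF assms, of "entry_time x"] z_antimono[of m "entry_time x"] by auto
next
  assume "x < z m"
  show "m \<le> entry_time x"
  proof (rule ccontr)
    assume "\<not> m \<le> entry_time x"
    then have "z m \<le> z (Suc (entry_time x))" by (intro z_antimono) auto
    then show False using entry_eq_iff[OF assms, of "entry_time x"] \<open>x < z m\<close> by auto
  qed
qed

lemma f_g:
  assumes "y \<in> circle"
  shows "f (g y) = y"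
proof -
  have "0 \<le> g y" "g y < 1/2"
    using assms g_props[of y] g_less_iff[of y 1] by (auto simp: circle_def)
  then show ?thesis using f_left g_props(3)[of y] assms by (simp add: circle_def)
qed

lemma f_half: "0 \<le> y \<Longrightarrow> f ((y + 1) / 2) = y"
  by (simp add: f_right field_simps)

lemma g_pow_circle: "y \<in> circle \<Longrightarrow> (g ^^ n) y \<in> circle"
  using g_pow_range[of y n] g_pow_less[of y 1 n] g_pow_range[of 1 n] by (auto simp: circle_def)

lemma f_pow_g_pow: "y \<in> circle \<Longrightarrow> b \<le> n \<Longrightarrow> (f ^^ b) ((g ^^ n) y) = (g ^^ (n - b)) y"
proof (induction b)
  case (Suc b)
  then obtain k where k: "n - b = Suc k" "n - Suc b = k"
    by (metis Suc_diff_Suc Suc_le_lessD)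
  with Suc show ?case using f_g[OF g_pow_circle[of y k]] by simp
qed simp

lemma branch1_in:
  assumes "y \<in> circle"
  shows "z (Suc a) \<le> branch1 a y" "branch1 a y < z a"
  using assms g_pow_le[of "1/2" "(y + 1) / 2" a] g_pow_less[of "(y + 1) / 2" 1 a] g_pow_z[of a 1]
  by (auto simp: branch1_def circle_def z_def funpow_swap1)

lemma branch1_pos: "y \<in> circle \<Longrightarrow> 0 < branch1 a y" "y \<in> circle \<Longrightarrow> branch1 a y < 1"
  using branch1_in[of y a] z_pos[of "Suc a"] z_range[of a] by auto

lemma entry_branch1: "y \<in> circle \<Longrightarrow> entry_time (branch1 a y) = a"
  using entry_eq_iff branch1_pos branch1_in by blast

lemma f_pow_branch1:
  assumes "y \<in> circle" "b \<le> a"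
  shows "(f ^^ b) (branch1 a y) = branch1 (a - b) y"
  using f_pow_g_pow[of "(y + 1) / 2" b a] assms by (simp add: branch1_def circle_def)

lemma jump_branch1: "y \<in> circle \<Longrightarrow> jump (branch1 a y) = y"
proof -
  assume y: "y \<in> circle"
  have "(f ^^ a) (branch1 a y) = (y + 1) / 2"
    using f_pow_branch1[OF y, of a a] by (simp add: branch1_def)
  moreover have "jump (branch1 a y) = f ((f ^^ a) (branch1 a y))"
    by (simp add: jump_def entry_branch1[OF y])
  ultimately show ?thesis using f_half[of y] y by (simp only: circle_def atLeastLessThan_iff)
qed

lemma g_image: "0 \<le> u \<Longrightarrow> v \<le> 1 \<Longrightarrow> u \<le> v \<Longrightarrow> g ` {u..<v} = {g u..<g v}"
proof (intro equalityI subsetI)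
  fix x assume *: "0 \<le> u" "v \<le> 1" "u \<le> v" "x \<in> {g u..<g v}"
  have r: "0 \<le> x" "x \<le> 1/2" using * g_props[of u] g_props[of v] by auto
  have "left_map \<alpha> x \<in> {u..<v}"
    using * r left_map_le_iff[of "g u" x] left_map_less_iff[of x "g v"] g_props[of u] g_props[of v] by auto
  then show "x \<in> g ` {u..<v}" using g_left_map[OF r] by (metis imageI)
qed (auto simp: g_less_iff g_le_iff)

lemma g_pow_image:
  assumes "0 \<le> u" "v \<le> 1" "u \<le> v"
  shows "(g ^^ n) ` {u..<v} = {(g ^^ n) u..<(g ^^ n) v}"
proof (induction n)
  case (Suc n)
  have "(g ^^ Suc n) ` {u..<v} = g ` (g ^^ n) ` {u..<v}" by (simp add: image_comp)
  also have "\<dots> = {g ((g ^^ n) u)..<g ((g ^^ n) v)}"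
    using assms g_pow_range[of u n] g_pow_range[of v n] g_pow_le[of u v n] unfolding Suc
    by (intro g_image) auto
  finally show ?case by simp
qed simp

lemma half_image: "(\<lambda>y. (y + 1) / 2) ` {u..<v} = {(u + 1) / 2..<(v + 1) / (2 :: real)}"
proof (intro equalityI subsetI)
  fix x assume "x \<in> {(u + 1) / 2..<(v + 1) / (2 :: real)}"
  then have "2 * x - 1 \<in> {u..<v}" "x = (2 * x - 1 + 1) / 2" by (auto simp: field_simps)
  then show "x \<in> (\<lambda>y. (y + 1) / 2) ` {u..<v}" by blast
qed auto

lemma branch1_image:
  assumes "0 \<le> u" "v \<le> 1" "u \<le> v"
  shows "branch1 a ` {u..<v} = {branch1 a u..<branch1 a v}"
proof -
  have "branch1 a ` {u..<v} = (g ^^ a) ` (\<lambda>y. (y + 1) / 2) ` {u..<v}"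
    by (simp add: branch1_def [abs_def] image_image)
  also have "\<dots> = {branch1 a u..<branch1 a v}"
    unfolding half_image using assms by (subst g_pow_image) (auto simp: branch1_def)
  finally show ?thesis .
qed

lemma branch_le: "u \<in> {0..1} \<Longrightarrow> v \<in> {0..1} \<Longrightarrow> u \<le> v \<Longrightarrow> branch w u \<le> branch w v"
  using branch_less[of u v w] by (cases "u = v") auto

lemma branch_image:
  assumes "0 \<le> u" "v \<le> 1" "u \<le> v"
  shows "branch w ` {u..<v} = {branch w u..<branch w v}"
proof (induction w)
  case (Cons a w)
  have "branch (a # w) ` {u..<v} = branch1 a ` branch w ` {u..<v}" by (simp add: image_comp)
  also have "\<dots> = {branch1 a (branch w u)..<branch1 a (branch w v)}"
    using assms branch_range[of u w] branch_range[of v w] branch_le[of u v w] unfolding Cons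
    by (intro branch1_image) auto
  finally show ?case by simp
qed simp

lemma branch_circle: "y \<in> circle \<Longrightarrow> branch w y \<in> circle"
  using branch_range[of y w] branch_less[of y 1 w] branch_range[of 1 w] by (auto simp: circle_def)

text \<open>The branches of \<open>jump\<close> are full: the fundamental intervals tile \<open>(0, 1)\<close>, and each is mapped onto the circle.\<close>
lemma branch1_entry_jump:
  assumes "0 < x" "x < 1"
  shows "branch1 (entry_time x) (jump x) = x" "jump x \<in> circle"
proof -
  have "z (Suc (entry_time x)) \<le> x \<and> x < z (entry_time x)" using entry_eq_iff[OF assms] by blast
  then have "x \<in> {branch1 (entry_time x) 0..<branch1 (entry_time x) 1}"
    using g_pow_z[of "entry_time x" 1] by (auto simp: branch1_def z_def funpow_swap1)
  then obtain y where "y \<in> {0..<1}" "x = branch1 (entry_time x) y"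
    using branch1_image[of 0 1 "entry_time x"] by (metis imageE order.refl zero_le_one)
  then show "branch1 (entry_time x) (jump x) = x" "jump x \<in> circle"
    using jump_branch1[of y "entry_time x"] by (auto simp: circle_def)
qed

lemma jump_pow_branch: "y \<in> circle \<Longrightarrow> (jump ^^ length w) (branch w y) = y"
  by (induction w) (auto simp: funpow_swap1 jump_branch1 branch_circle)

lemma exc_Suc: "exc (Suc i) x = exc i (jump x)"
  by (simp add: exc_def funpow_swap1)

lemma exc_branch: "y \<in> circle \<Longrightarrow> i < length w \<Longrightarrow> exc i (branch w y) = w ! i"
proof (induction w arbitrary: i)
  case (Cons a w)
  then show ?case
    by (cases i) (auto simp: exc_Suc jump_branch1 branch_circle entry_branch1 exc_def[of 0])
qed simp

section \<open>Points with infinitely many digits 1\<close>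

text \<open>The points whose orbit never hits the fixed point \<open>0\<close>. On this set every excursion is finite, so the
  excursion lengths code the whole digit sequence; its complement in the circle is countable.\<close>
definition Om :: "real set" where
  "Om = {x \<in> circle. \<forall>n. (f ^^ n) x \<noteq> 0}"

lemma Om_pos: "x \<in> Om \<Longrightarrow> 0 < x" "x \<in> Om \<Longrightarrow> x < 1"
proof -
  assume "x \<in> Om"
  then have "x \<in> {0..<1}" "(f ^^ 0) x \<noteq> 0" unfolding Om_def circle_def by blast+
  then show "0 < x" "x < 1" by auto
qed

lemma f_pow_Om: "x \<in> Om \<Longrightarrow> (f ^^ n) x \<in> Om"
proof -
  assume x: "x \<in> Om"
  have "(f ^^ n) x \<in> circle"
    by (induction n) (use x intermittent_map_in_circle alpha_ge_1 in \<open>auto simp: Om_def\<close>)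
  moreover have "(f ^^ m) ((f ^^ n) x) \<noteq> 0" for m
    using x unfolding Om_def by (metis (mono_tags, lifting) comp_apply funpow_add mem_Collect_eq)
  ultimately show ?thesis by (simp add: Om_def)
qed

lemma jump_pow_Om: "x \<in> Om \<Longrightarrow> (jump ^^ n) x \<in> Om"
proof (induction n)
  case (Suc n)
  then show ?case using f_pow_Om[of "(jump ^^ n) x" "Suc (entry_time ((jump ^^ n) x))"] jump_def[of "(jump ^^ n) x"] by simp
qed simp

definition itin :: "nat \<Rightarrow> real \<Rightarrow> nat list" where
  "itin n x = map (\<lambda>i. exc i x) [0..<n]"

lemma length_itin [simp]: "length (itin n x) = n"
  by (simp add: itin_def)

lemma itin_Suc: "itin (Suc n) x = exc 0 x # itin n (jump x)"
  unfolding itin_def by (simp add: exc_Suc[symmetric] map_upt_Suc del: upt_Suc)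

lemma branch_itin: "x \<in> Om \<Longrightarrow> branch (itin n x) ((jump ^^ n) x) = x"
proof (induction n arbitrary: x)
  case (Suc n)
  from Suc.IH[OF jump_pow_Om[OF Suc.prems, of 1]] show ?case
    using branch1_entry_jump[of x] Om_pos[OF Suc.prems] by (simp add: itin_Suc funpow_swap1 exc_def)
qed (simp add: itin_def)

lemma itin_branch: "y \<in> circle \<Longrightarrow> itin (length w) (branch w y) = w"
  by (rule nth_equalityI) (auto simp: itin_def exc_branch)

lemma countable_orbit_0: "countable {x \<in> circle. (f ^^ n) x = 0}"
proof (induction n)
  case 0
  show ?case by (rule countable_subset[of _ "{0}"]) auto
next
  case (Suc n)
  have "{x \<in> circle. (f ^^ Suc n) x = 0}
     \<subseteq> g ` {x \<in> circle. (f ^^ n) x = 0} \<union> (\<lambda>y. (y + 1) / 2) ` {x \<in> circle. (f ^^ n) x = 0}"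
  proof
    fix x assume x: "x \<in> {x \<in> circle. (f ^^ Suc n) x = 0}"
    then have fx: "f x \<in> {x \<in> circle. (f ^^ n) x = 0}"
      using intermittent_map_in_circle alpha_ge_1 by (simp add: funpow_swap1)
    show "x \<in> g ` {x \<in> circle. (f ^^ n) x = 0} \<union> (\<lambda>y. (y + 1) / 2) ` {x \<in> circle. (f ^^ n) x = 0}"
    proof (cases "x < 1/2")
      case True
      then have "x = g (f x)" using x f_left g_left_map[of x] by (auto simp: circle_def)
      then show ?thesis using fx by blast
    next
      case False
      then have "x = (f x + 1) / 2" by (simp add: f_right)
      then show ?thesis using fx by blast
    qed
  qed
  then show ?case using Suc by (meson countable_Un countable_image countable_subset)
qed

lemma countable_circle_minus_Om: "countable (circle - Om)"
proof -
  have "circle - Om = (\<Union>n. {x \<in> circle. (f ^^ n) x = 0})" by (auto simp: Om_def)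
  then show ?thesis using countable_orbit_0 by auto
qed

lemma Om_borel: "Om \<in> sets borel"
proof -
  have "circle - Om \<in> sets borel"
    using countable_circle_minus_Om by (rule sets.countable[rotated]) simp
  moreover have "circle \<in> sets borel" by (simp add: circle_def)
  ultimately have "circle - (circle - Om) \<in> sets borel" by (rule sets.Diff[rotated])
  also have "circle - (circle - Om) = Om" by (auto simp: Om_def)
  finally show ?thesis .
qed

text \<open>Lebesgue measure on \<open>Om\<close>, the probability measure of all almost-sure statements below.\<close>
definition M :: "real measure" where "M = restrict_space lborel Om"

lemma space_M [simp]: "space M = Om"
  by (simp add: M_def space_restrict_space)

lemma sets_M: "A \<in> sets M \<longleftrightarrow> A \<subseteq> Om \<and> A \<in> sets borel"
  using Om_borel by (simp add: M_def sets_restrict_space_iff conj_commute)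

lemma emeasure_M: "A \<subseteq> Om \<Longrightarrow> emeasure M A = emeasure lborel A"
  using Om_borel by (simp add: M_def emeasure_restrict_space)

lemma emeasure_M_interval:
  assumes "0 \<le> p" "p \<le> q" "q \<le> 1"
  shows "emeasure M ({p..<q} \<inter> Om) = ennreal (q - p)"
proof -
  have "emeasure lborel ({p..<q} \<inter> Om) = emeasure lborel {p..<q}"
  proof (rule emeasure_eq_AE)
    have "AE x in lborel. x \<notin> circle - Om"
      using countable_circle_minus_Om countable_imp_null_set_lborel AE_not_in by blast
    then show "AE x in lborel. (x \<in> {p..<q} \<inter> Om) = (x \<in> {p..<q})"
      by eventually_elim (use assms in \<open>auto simp: circle_def\<close>)
  qed (use Om_borel in auto)
  then show ?thesis using assms by (simp add: emeasure_M)
qed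

lemma finite_measure_M: "finite_measure M"
proof (rule finite_measureI)
  have "{0..<1} \<inter> Om = Om" by (auto simp: Om_def circle_def)
  then show "emeasure M (space M) \<noteq> \<infinity>" using emeasure_M_interval[of 0 1] by simp
qed

sublocale finite_measure M by (rule finite_measure_M)

lemma measure_M_Om: "measure M Om = 1"
proof -
  have "{0..<1} \<inter> Om = Om" by (auto simp: Om_def circle_def)
  then show ?thesis using emeasure_M_interval[of 0 1] by (simp add: measure_def)
qed

section \<open>Approximate independence of excursions\<close>

text \<open>Events that depend on the lengths of the first \<open>n\<close> excursions only. They are countable unions of
  cylinders, up to points outside \<open>Om\<close>.\<close>
definition determined :: "nat \<Rightarrow> real set \<Rightarrow> bool" where
  "determined n A \<longleftrightarrow> A \<subseteq> Om \<and> (\<forall>x\<in>A. \<forall>y\<in>Om. (\<forall>i<n. exc i x = exc i y) \<longrightarrow> y \<in> A)"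

text \<open>On each cylinder \<open>jump\<^sup>n\<close> is inverted by \<open>branch w\<close>, so the condition on \<open>jump\<^sup>n x\<close> cuts an interval out
  of each cylinder.\<close>
lemma determined_decomp:
  assumes A: "determined n A" and uv: "0 \<le> u" "u \<le> v" "v \<le> 1"
  shows "A \<inter> {x. (jump ^^ n) x \<in> {u..<v}} = (\<Union>w\<in>itin n ` A. {branch w u..<branch w v} \<inter> Om)"
proof (intro equalityI subsetI)
  fix x assume x: "x \<in> A \<inter> {x. (jump ^^ n) x \<in> {u..<v}}"
  then have "x \<in> Om" using A by (auto simp: determined_def)
  have "x \<in> branch (itin n x) ` {u..<v}"
    using branch_itin[OF \<open>x \<in> Om\<close>, of n] x by (metis IntD2 imageI mem_Collect_eq)
  then have "x \<in> {branch (itin n x) u..<branch (itin n x) v}"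
    using branch_image uv by blast
  then show "x \<in> (\<Union>w\<in>itin n ` A. {branch w u..<branch w v} \<inter> Om)"
    using x \<open>x \<in> Om\<close> by blast
next
  fix y assume "y \<in> (\<Union>w\<in>itin n ` A. {branch w u..<branch w v} \<inter> Om)"
  then obtain x where x: "x \<in> A" "y \<in> {branch (itin n x) u..<branch (itin n x) v}" "y \<in> Om" by blast
  then obtain t where t: "t \<in> {u..<v}" "y = branch (itin n x) t"
    using branch_image[OF uv(1,3,2), of "itin n x"] by (metis imageE)
  then have "t \<in> circle" using uv by (auto simp: circle_def)
  then have "itin n y = itin n x" "(jump ^^ n) y = t"
    using itin_branch[of t "itin n x"] jump_pow_branch[of t "itin n x"] t by auto
  moreover have "exc i y = exc i x" if "i < n" for i
    using exc_branch[OF \<open>t \<in> circle\<close>, of i "itin n x"] that t by (simp add: itin_def)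
  ultimately show "y \<in> A \<inter> {x. (jump ^^ n) x \<in> {u..<v}}"
    using A x t by (auto simp: determined_def)
qed

lemma emeasure_determined:
  assumes A: "determined n A" and uv: "0 \<le> u" "u \<le> v" "v \<le> 1"
  shows "A \<inter> {x. (jump ^^ n) x \<in> {u..<v}} \<in> sets M" (is "?B \<in> _")
    and "emeasure M (A \<inter> {x. (jump ^^ n) x \<in> {u..<v}})
      = (\<integral>\<^sup>+w. ennreal (branch w v - branch w u) \<partial>count_space (itin n ` A))"
proof -
  let ?X = "\<lambda>w. {branch w u..<branch w v} \<inter> Om"
  have sets: "?X w \<in> sets M" for w
    using Om_borel by (simp add: sets_M)
  have cnt: "countable (itin n ` A)" by simp
  show "?B \<in> sets M"
    unfolding determined_decomp[OF A uv] by (rule sets.countable_UN'[OF cnt]) (use sets in blast)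
  have disj: "disjoint_family_on ?X (itin n ` A)"
    unfolding disjoint_family_on_def
  proof (intro ballI impI)
    fix w w' assume w: "w \<in> itin n ` A" "w' \<in> itin n ` A" "w \<noteq> w'"
    have False if y: "y \<in> {branch w u..<branch w v}" "y \<in> {branch w' u..<branch w' v}" for y
    proof -
      obtain t where t: "t \<in> {u..<v}" "y = branch w t"
        using branch_image[OF uv(1,3,2), of w] y by (metis imageE)
      obtain t' where t': "t' \<in> {u..<v}" "y = branch w' t'"
        using branch_image[OF uv(1,3,2), of w'] y by (metis imageE)
      have "t \<in> circle" "t' \<in> circle" using t t' uv by (auto simp: circle_def)
      then have "itin (length w) y = w" "itin (length w') y = w'"
        using itin_branch[of t w] itin_branch[of t' w'] t(2) t'(2) by simp_all
      moreover have "length w = length w'" using w by auto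
      ultimately show False using w(3) by simp
    qed
    then show "?X w \<inter> ?X w' = {}" by blast
  qed
  have "emeasure M ?B = (\<integral>\<^sup>+w. emeasure M (?X w) \<partial>count_space (itin n ` A))"
    unfolding determined_decomp[OF A uv] by (rule emeasure_UN_countable[OF sets cnt disj])
  also have "\<dots> = (\<integral>\<^sup>+w. ennreal (branch w v - branch w u) \<partial>count_space (itin n ` A))"
  proof (intro nn_integral_cong emeasure_M_interval)
    fix w
    show "0 \<le> branch w u" "branch w v \<le> 1" "branch w u \<le> branch w v"
      using uv branch_range[of u w] branch_range[of v w] branch_le[of u v w] by auto
  qed
  finally show "emeasure M ?B = (\<integral>\<^sup>+w. ennreal (branch w v - branch w u) \<partial>count_space (itin n ` A))" .
qed

lemma determined_whole:
  assumes "determined n A"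
  shows "A \<inter> {x. (jump ^^ n) x \<in> {0..<1}} = A"
proof -
  have "0 \<le> (jump ^^ n) x \<and> (jump ^^ n) x < 1" if "x \<in> A" for x
  proof -
    have "(jump ^^ n) x \<in> Om" using jump_pow_Om that assms unfolding determined_def by blast
    then show ?thesis using Om_pos[of "(jump ^^ n) x"] by simp
  qed
  then show ?thesis by auto
qed

lemma determined_sets: "determined n A \<Longrightarrow> A \<in> sets M"
  using emeasure_determined(1)[of n A 0 1] determined_whole[of n A] by simp

text \<open>This and the next lemma say that the future after \<open>n\<close> excursions is independent of the past up to the
  factor \<open>dist_const\<close>: \<open>branch_bounds\<close> is summed over the cylinders that make up \<open>A\<close>.\<close>
lemma measure_determined_le:
  assumes A: "determined n A" and uv: "0 \<le> u" "u \<le> v" "v \<le> 1"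
  shows "measure M (A \<inter> {x. (jump ^^ n) x \<in> {u..<v}}) \<le> dist_const * (v - u) * measure M A"
proof -
  let ?B = "A \<inter> {x. (jump ^^ n) x \<in> {u..<v}}"
  have len: "0 \<le> branch w 1 - branch w 0" for w using branch_le[of 0 1 w] by simp
  have c: "0 \<le> dist_const * (v - u)" using dist_const_ge_1 uv by simp
  have "emeasure M ?B = (\<integral>\<^sup>+w. ennreal (branch w v - branch w u) \<partial>count_space (itin n ` A))"
    by (rule emeasure_determined(2)[OF A uv])
  also have "\<dots> \<le> (\<integral>\<^sup>+w. ennreal (dist_const * (v - u)) * ennreal (branch w 1 - branch w 0)
      \<partial>count_space (itin n ` A))"
    using branch_bounds(1)[OF uv] len c
    by (intro nn_integral_mono) (simp add: ennreal_mult[symmetric] ennreal_leI)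
  also have "\<dots> = ennreal (dist_const * (v - u)) * emeasure M A"
    using emeasure_determined(2)[OF A, of 0 1] determined_whole[OF A] by (simp add: nn_integral_cmult)
  finally show ?thesis
    using c by (simp add: emeasure_eq_measure ennreal_mult[symmetric] ennreal_le_iff)
qed

lemma measure_determined_ge:
  assumes A: "determined n A" and uv: "0 \<le> u" "u \<le> v" "v \<le> 1"
  shows "(v - u) / dist_const * measure M A \<le> measure M (A \<inter> {x. (jump ^^ n) x \<in> {u..<v}})"
proof -
  let ?B = "A \<inter> {x. (jump ^^ n) x \<in> {u..<v}}"
  have len: "0 \<le> branch w 1 - branch w 0" for w using branch_le[of 0 1 w] by simp
  have c: "0 \<le> (v - u) / dist_const" using dist_const_ge_1 uv by simp
  have "ennreal ((v - u) / dist_const) * emeasure M A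
      = (\<integral>\<^sup>+w. ennreal ((v - u) / dist_const) * ennreal (branch w 1 - branch w 0)
      \<partial>count_space (itin n ` A))"
    using emeasure_determined(2)[OF A, of 0 1] determined_whole[OF A] by (simp add: nn_integral_cmult)
  also have "\<dots> \<le> (\<integral>\<^sup>+w. ennreal (branch w v - branch w u) \<partial>count_space (itin n ` A))"
    using branch_bounds(2)[OF uv] len c
    by (intro nn_integral_mono) (simp add: ennreal_mult[symmetric] ennreal_leI)
  also have "\<dots> = emeasure M ?B"
    by (rule emeasure_determined(2)[OF A uv, symmetric])
  finally show ?thesis
    using c by (simp add: emeasure_eq_measure ennreal_mult[symmetric] ennreal_le_iff)
qed

lemma determinedI:
  assumes "\<And>x y. x \<in> Om \<Longrightarrow> y \<in> Om \<Longrightarrow> (\<And>i. i < n \<Longrightarrow> exc i x = exc i y) \<Longrightarrow> P x \<Longrightarrow> P y"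
  shows "determined n {x \<in> Om. P x}"
  using assms unfolding determined_def by blast

lemma determinedD:
  "determined n A \<Longrightarrow> x \<in> A \<Longrightarrow> y \<in> Om \<Longrightarrow> \<forall>i<n. exc i x = exc i y \<Longrightarrow> y \<in> A"
  unfolding determined_def by blast

lemma determined_Om: "determined n Om"
  unfolding determined_def by blast

lemma exc_add: "exc (n + i) x = exc i ((jump ^^ n) x)"
  by (metis add.commute comp_apply exc_def funpow_add)

lemma exc_ge_iff: "x \<in> Om \<Longrightarrow> m \<le> exc n x \<longleftrightarrow> (jump ^^ n) x \<in> {0..<z m}"
  using entry_ge_iff[of "(jump ^^ n) x" m] jump_pow_Om[of x n] Om_pos[of "(jump ^^ n) x"] by (auto simp: exc_def)

text \<open>Excursions of length \<open>0\<close> use the branch \<open>2 y - 1\<close>, which doubles the distance to the fixed point \<open>1\<close>.\<close>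
lemma zeros_at_start_iff: "y \<in> Om \<Longrightarrow> (\<forall>i<k. exc i y = 0) \<longleftrightarrow> 1 - (1/2) ^ k \<le> y"
proof (induction k arbitrary: y)
  case 0
  then show ?case using Om_pos by (simp add: order_less_imp_le)
next
  case (Suc k)
  have y: "0 < y" "y < 1" using Om_pos Suc.prems by auto
  have h: "entry_time y = 0 \<longleftrightarrow> 1/2 \<le> y" using entry_eq_iff[OF y, of 0] y by auto
  have "(\<forall>i<Suc k. exc i y = 0) \<longleftrightarrow> entry_time y = 0 \<and> (\<forall>i<k. exc i (jump y) = 0)"
    by (auto simp: All_less_Suc2 exc_Suc exc_def[of 0])
  also have "\<dots> \<longleftrightarrow> entry_time y = 0 \<and> 1 - (1/2) ^ k \<le> jump y"
    using Suc.IH[of "jump y"] jump_pow_Om[OF Suc.prems, of 1] by simp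
  also have "\<dots> \<longleftrightarrow> 1/2 \<le> y \<and> 1 - (1/2) ^ k \<le> 2 * y - 1"
    unfolding h[symmetric] by (rule conj_cong) (use h in \<open>auto simp: jump_def f_right\<close>)
  also have "\<dots> \<longleftrightarrow> 1 - (1/2) ^ Suc k \<le> y"
  proof -
    have "(1/2) ^ Suc k \<le> (1/2 :: real)" by (simp add: power_le_one)
    then show ?thesis by auto
  qed
  finally show ?case .
qed

lemma zeros_iff: "x \<in> Om \<Longrightarrow> (\<forall>i<k. exc (n + i) x = 0) \<longleftrightarrow> (jump ^^ n) x \<in> {1 - (1/2) ^ k..<1}"
  using zeros_at_start_iff[OF jump_pow_Om, of x k n] Om_pos[OF jump_pow_Om, of x n] by (simp add: exc_add)

lemma sets_pow: "0 \<le> u \<Longrightarrow> u \<le> v \<Longrightarrow> v \<le> 1 \<Longrightarrow> {x \<in> Om. (jump ^^ n) x \<in> {u..<v}} \<in> sets M"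
  using emeasure_determined(1)[OF determined_Om, of u v n] by (simp add: Int_def)

lemma measure_pow_le:
  "0 \<le> u \<Longrightarrow> u \<le> v \<Longrightarrow> v \<le> 1 \<Longrightarrow> measure M {x \<in> Om. (jump ^^ n) x \<in> {u..<v}} \<le> dist_const * (v - u)"
  using measure_determined_le[OF determined_Om, of u v n] by (simp add: Int_def measure_M_Om)

lemma exc_ge_prob:
  shows "{x \<in> Om. m \<le> exc n x} \<in> sets M"
    and "measure M {x \<in> Om. m \<le> exc n x} \<le> dist_const * (1 + real m) powr (- 1 / \<alpha>)"
proof -
  have e: "{x \<in> Om. m \<le> exc n x} = {x \<in> Om. (jump ^^ n) x \<in> {0..<z m}}"
    using exc_ge_iff by blast
  have z: "0 \<le> z m" "z m \<le> 1" using z_range[of m] by auto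
  show "{x \<in> Om. m \<le> exc n x} \<in> sets M" unfolding e using z by (intro sets_pow) auto
  have "measure M {x \<in> Om. m \<le> exc n x} \<le> dist_const * z m"
    unfolding e using measure_pow_le[of 0 "z m" n] z by simp
  also have "\<dots> \<le> dist_const * (1 + real m) powr (- 1 / \<alpha>)"
    using dist_const_ge_1 z_upper by (intro mult_left_mono) auto
  finally show "measure M {x \<in> Om. m \<le> exc n x} \<le> dist_const * (1 + real m) powr (- 1 / \<alpha>)" .
qed

lemma zeros_prob:
  shows "{x \<in> Om. \<forall>i<k. exc (n + i) x = 0} \<in> sets M"
    and "measure M {x \<in> Om. \<forall>i<k. exc (n + i) x = 0} \<le> dist_const * (1/2) ^ k"
proof -
  have e: "{x \<in> Om. \<forall>i<k. exc (n + i) x = 0} = {x \<in> Om. (jump ^^ n) x \<in> {1 - (1/2) ^ k..<1}}"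
    using zeros_iff by blast
  have p: "0 \<le> 1 - (1/2 :: real) ^ k" "1 - (1/2 :: real) ^ k \<le> 1" by (auto simp: power_le_one)
  show "{x \<in> Om. \<forall>i<k. exc (n + i) x = 0} \<in> sets M" unfolding e using p by (intro sets_pow) auto
  show "measure M {x \<in> Om. \<forall>i<k. exc (n + i) x = 0} \<le> dist_const * (1/2) ^ k"
    unfolding e using measure_pow_le[OF p, of n] by simp
qed

section \<open>Almost sure behaviour of the excursion lengths\<close>

text \<open>Repeated trials: one attempt to hit \<open>[u, v)\<close> every \<open>l\<close> excursions. The outcome of an attempt must be
  settled before the next one starts. Given the past, each attempt succeeds with probability at least
  \<open>(v - u) / dist_const\<close>, so the probability that all of them fail decays exponentially.\<close>
lemma trials_fail:
  assumes uv: "0 \<le> u" "u \<le> v" "v \<le> 1"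
    and det: "\<And>r. determined (Suc r * l) {x \<in> Om. (jump ^^ (r * l)) x \<notin> {u..<v}}"
  shows "determined (k * l) {x \<in> Om. \<forall>r<k. (jump ^^ (r * l)) x \<notin> {u..<v}}"
    and "measure M {x \<in> Om. \<forall>r<k. (jump ^^ (r * l)) x \<notin> {u..<v}} \<le> exp (- ((v - u) / dist_const) * real k)"
proof -
  let ?A = "\<lambda>k. {x \<in> Om. \<forall>r<k. (jump ^^ (r * l)) x \<notin> {u..<v}}"
  show A: "determined (k * l) (?A k)" for k
  proof (rule determinedI, intro allI impI)
    fix x y r
    assume xy: "x \<in> Om" "y \<in> Om" "\<And>i. i < k * l \<Longrightarrow> exc i x = exc i y"
      "\<forall>r<k. (jump ^^ (r * l)) x \<notin> {u..<v}" and r: "r < k"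
    have "Suc r * l \<le> k * l" using r by (intro mult_right_mono) auto
    then have "\<forall>i<Suc r * l. exc i x = exc i y" using xy(3) less_le_trans by blast
    moreover have "x \<in> {x \<in> Om. (jump ^^ (r * l)) x \<notin> {u..<v}}" using xy(1,4) r by blast
    ultimately have "y \<in> {x \<in> Om. (jump ^^ (r * l)) x \<notin> {u..<v}}"
      by (intro determinedD[OF det[of r] _ xy(2)])
    then show "(jump ^^ (r * l)) y \<notin> {u..<v}" by blast
  qed
  show "measure M (?A k) \<le> exp (- ((v - u) / dist_const) * real k)"
  proof (induction k)
    case 0
    then show ?case by (simp add: measure_M_Om)
  next
    case (Suc k)
    let ?p = "(v - u) / dist_const" and ?B = "?A k \<inter> {x. (jump ^^ (k * l)) x \<in> {u..<v}}"
    have split: "{x \<in> Om. h x \<notin> S \<and> P x} = {x \<in> Om. P x} - ({x \<in> Om. P x} \<inter> {x. h x \<in> S})"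
      for h :: "real \<Rightarrow> real" and S P by blast
    have Ak: "determined (k * l) (?A k)" by (rule A)
    have AM: "?A k \<in> sets M" by (rule determined_sets[OF Ak])
    have BM: "?B \<in> sets M" by (rule emeasure_determined(1)[OF Ak uv])
    have step: "?A (Suc k) = ?A k - ?B" unfolding All_less_Suc by (rule split)
    have "measure M (?A (Suc k)) = measure M (?A k) - measure M ?B"
      unfolding step by (rule finite_measure_Diff[OF AM BM Int_lower1])
    moreover have "?p * measure M (?A k) \<le> measure M ?B"
      by (rule measure_determined_ge[OF Ak uv])
    ultimately have "measure M (?A (Suc k)) \<le> (1 + - ?p) * measure M (?A k)"
      unfolding distrib_right by linarith
    also have "\<dots> \<le> exp (- ?p) * measure M (?A k)"
      by (intro mult_right_mono exp_ge_add_one_self) (rule measure_nonneg)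
    also have "\<dots> \<le> exp (- ?p) * exp (- ?p * real k)"
      by (rule mult_left_mono[OF Suc]) simp
    also have "\<dots> = exp (- ?p * real (Suc k))"
      by (simp only: mult_exp_exp of_nat_Suc distrib_left mult_1_right)
    finally show ?case .
  qed
qed

lemma summable_exp_linear:
  assumes "c > 0"
  shows "summable (\<lambda>j. exp (- c * real j))"
proof -
  have "summable (\<lambda>j. exp (- c) ^ j)" using assms by (intro summable_geometric) simp
  moreover have "exp (- c) ^ j = exp (- c * real j)" for j
    by (simp only: exp_of_nat_mult[symmetric] mult.commute)
  ultimately show ?thesis by (simp only:)
qed

lemma eventually_not_in:
  assumes "\<And>j. A j \<in> sets M" "\<And>j. measure M (A j) \<le> b j" "summable b"
  shows "AE x in M. \<forall>\<^sub>F j in sequentially. x \<notin> A j"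
proof -
  have "summable (\<lambda>j. measure M (A j))"
  proof (rule summable_comparison_test'[OF assms(3), of 0])
    show "norm (measure M (A n)) \<le> b n" for n using assms(2)[of n] by simp
  qed
  moreover have "emeasure M (A j) < \<infinity>" for j
    using emeasure_finite[of "A j"] by (simp add: less_top[symmetric])
  ultimately have "AE x in M. \<forall>\<^sub>F j in sequentially. x \<in> space M - A j"
    using assms(1) by (intro borel_cantelli_AE1)
  then show ?thesis
  proof eventually_elim
    case (elim x)
    then show ?case by (rule eventually_mono) simp
  qed
qed

text \<open>Among this many excursions one of length at least \<open>2\<^sup>j\<close> occurs, almost surely for all large \<open>j\<close>. Such an
  excursion has probability of order \<open>2\<close> to the power \<open>-j/\<alpha>\<close>; the additional factor \<open>j\<close> makes the failure
  probabilities summable.\<close>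
definition stage :: "nat \<Rightarrow> nat" where "stage j = nat \<lceil>real j * 2 powr (real j / \<alpha>)\<rceil>"

lemma stage_ge: "real j * 2 powr (real j / \<alpha>) \<le> real (stage j)"
  unfolding stage_def by linarith

lemma stage_le: "real (stage j) \<le> real j * 2 powr (real j / \<alpha>) + 1"
proof -
  have "0 \<le> real j * 2 powr (real j / \<alpha>)" by simp
  then show ?thesis unfolding stage_def by linarith
qed

lemma long_excursion_early: "AE x in M. \<forall>\<^sub>F j in sequentially. \<exists>i<stage j. 2 ^ j \<le> exc i x"
proof -
  define c where "c = tail_const * 2 powr (- 1 / \<alpha>) / dist_const"
  have c: "c > 0" using tail_const_pos dist_const_ge_1 by (simp add: c_def)
  let ?A = "\<lambda>j. {x \<in> Om. \<forall>r<stage j. (jump ^^ (r * 1)) x \<notin> {0..<z (2 ^ j)}}"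
  have z: "0 \<le> (0::real)" "0 \<le> z (2 ^ j)" "z (2 ^ j) \<le> 1" for j using z_range[of "2 ^ j"] by auto
  have det: "determined (Suc r * 1) {x \<in> Om. (jump ^^ (r * 1)) x \<notin> {0..<z (2 ^ j)}}" for r j
  proof (rule determinedI)
    fix x y assume "x \<in> Om" "y \<in> Om" "\<And>i. i < Suc r * 1 \<Longrightarrow> exc i x = exc i y"
      "(jump ^^ (r * 1)) x \<notin> {0..<z (2 ^ j)}"
    then show "(jump ^^ (r * 1)) y \<notin> {0..<z (2 ^ j)}"
      using exc_ge_iff[of x "2 ^ j" r] exc_ge_iff[of y "2 ^ j" r] by simp
  qed
  have bound: "measure M (?A j) \<le> exp (- c * real j)" for j
  proof -
    have "c * real j * dist_const = tail_const * (2 powr (- 1 / \<alpha>) * 2 powr (- real j / \<alpha>)) *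
        (real j * 2 powr (real j / \<alpha>))"
      using dist_const_ge_1 by (simp add: c_def powr_minus)
    \<comment> \<open>The factor \<open>2 powr (- 1 / \<alpha>)\<close> in \<open>c\<close> absorbs \<open>1 + 2\<^sup>j \<le> 2 * 2\<^sup>j\<close>.\<close>
    also have "2 powr (- 1 / \<alpha>) * 2 powr (- real j / \<alpha>) = (2 * 2 powr real j) powr (- 1 / \<alpha>)"
      by (simp add: powr_mult powr_powr)
    also have "tail_const * (2 * 2 powr real j) powr (- 1 / \<alpha>) * (real j * 2 powr (real j / \<alpha>))
        \<le> tail_const * (1 + real (2 ^ j)) powr (- 1 / \<alpha>) * real (stage j)"
      using tail_const_pos alpha_ge_1
      by (intro mult_mono powr_mono2' stage_ge) (auto simp: powr_realpow add_pos_pos)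
    also have "\<dots> \<le> z (2 ^ j) * real (stage j)" by (intro mult_right_mono z_lower) auto
    finally have "c * real j \<le> z (2 ^ j) / dist_const * real (stage j)"
      using dist_const_ge_1 by (simp add: pos_le_divide_eq)
    then have "exp (- ((z (2 ^ j) - 0) / dist_const) * real (stage j)) \<le> exp (- c * real j)" by simp
    with trials_fail(2)[OF z det] show ?thesis by (rule order_trans)
  qed
  have "AE x in M. \<forall>\<^sub>F j in sequentially. x \<notin> ?A j"
    by (rule eventually_not_in[where A = ?A, OF determined_sets[OF trials_fail(1)[OF z det]] bound
          summable_exp_linear[OF c]])
  moreover have "AE x in M. x \<in> Om" by (rule AE_I2) simp
  ultimately show ?thesis
  proof eventually_elim
    case (elim x)
    from elim(1) show ?case
    proof (rule eventually_mono)
      fix j assume "x \<notin> ?A j"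
      then obtain r where "r < stage j" "(jump ^^ r) x \<in> {0..<z (2 ^ j)}" using elim(2) by auto
      then show "\<exists>i<stage j. 2 ^ j \<le> exc i x" using exc_ge_iff[OF elim(2)] by blast
    qed
  qed
qed

text \<open>Here \<open>j\<close>\<open>2\<^sup>j\<close> disjoint blocks of \<open>j\<close> excursions are the trials, each with success probability of order
  \<open>2\<^sup>-\<^sup>j\<close>, so that again the failure probability is exponentially small in \<open>j\<close>.\<close>
lemma long_zero_run_early:
  "AE x in M. \<forall>\<^sub>F j in sequentially. \<exists>n. n + j \<le> j * j * 2 ^ j \<and> (\<forall>i<j. exc (n + i) x = 0)"
proof -
  define c where "c = 1 / dist_const"
  have c: "c > 0" using dist_const_ge_1 by (simp add: c_def)
  let ?A = "\<lambda>j. {x \<in> Om. \<forall>r<j * 2 ^ j. (jump ^^ (r * j)) x \<notin> {1 - (1/2) ^ j..<1}}"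
  have p: "0 \<le> 1 - (1/2 :: real) ^ j" "1 - (1/2 :: real) ^ j \<le> 1" "1 \<le> (1 :: real)" for j
    by (auto simp: power_le_one)
  have det: "determined (Suc r * j) {x \<in> Om. (jump ^^ (r * j)) x \<notin> {1 - (1/2) ^ j..<1}}" for r j
  proof (rule determinedI)
    fix x y assume *: "x \<in> Om" "y \<in> Om" "\<And>i. i < Suc r * j \<Longrightarrow> exc i x = exc i y"
      "(jump ^^ (r * j)) x \<notin> {1 - (1/2) ^ j..<1}"
    then have "\<forall>i<j. exc (r * j + i) x = exc (r * j + i) y" by simp
    then show "(jump ^^ (r * j)) y \<notin> {1 - (1/2) ^ j..<1}"
      using *(4) zeros_iff[OF *(1), of j "r * j"] zeros_iff[OF *(2), of j "r * j"] by auto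
  qed
  have bound: "measure M (?A j) \<le> exp (- c * real j)" for j
  proof -
    have "measure M (?A j) \<le> exp (- ((1 - (1 - (1/2) ^ j)) / dist_const) * real (j * 2 ^ j))"
      by (rule trials_fail(2)[OF p det])
    then show ?thesis by (simp add: c_def power_one_over)
  qed
  have "AE x in M. \<forall>\<^sub>F j in sequentially. x \<notin> ?A j"
    by (rule eventually_not_in[where A = ?A, OF determined_sets[OF trials_fail(1)[OF p det]] bound
          summable_exp_linear[OF c]])
  moreover have "AE x in M. x \<in> Om" by (rule AE_I2) simp
  ultimately show ?thesis
  proof eventually_elim
    case (elim x)
    from elim(1) show ?case
    proof (rule eventually_mono)
      fix j assume "x \<notin> ?A j"
      then obtain r where r: "r < j * 2 ^ j" "(jump ^^ (r * j)) x \<in> {1 - (1/2) ^ j..<1}"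
        using elim(2) by auto
      have "r * j + j = Suc r * j" by simp
      also have "\<dots> \<le> (j * 2 ^ j) * j" using r by (intro mult_right_mono) auto
      finally have "r * j + j \<le> j * j * 2 ^ j" by (simp add: mult_ac)
      then show "\<exists>n. n + j \<le> j * j * 2 ^ j \<and> (\<forall>i<j. exc (n + i) x = 0)"
        using zeros_iff[OF elim(2)] r by blast
    qed
  qed
qed

text \<open>Chosen so that the union bound over the \<open>stage j + 1\<close> starting points leaves a summable probability, while
  \<open>run_bound j\<close> is still \<open>j/\<alpha> + O(log j)\<close>.\<close>
definition run_bound :: "nat \<Rightarrow> nat" where "run_bound j = nat \<lceil>log 2 (real (stage j + 1) * real (j + 1) ^ 2)\<rceil>"

lemma run_bound_tail: "real (stage j + 1) * (1/2) ^ run_bound j \<le> 1 / real (j + 1) ^ 2"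
proof -
  have pos: "0 < real (stage j + 1) * real (j + 1) ^ 2" by simp
  have "real (stage j + 1) * real (j + 1) ^ 2 = 2 powr log 2 (real (stage j + 1) * real (j + 1) ^ 2)"
    using pos by simp
  also have "\<dots> \<le> 2 powr real (run_bound j)"
    unfolding run_bound_def by (intro powr_mono real_nat_ceiling_ge) simp
  also have "\<dots> = 2 ^ run_bound j" by (simp add: powr_realpow)
  finally have "real (stage j + 1) * real (j + 1) ^ 2 \<le> 2 ^ run_bound j" .
  then show ?thesis by (simp add: divide_simps power_one_over mult.commute)
qed

lemma no_longer_zero_run:
  "AE x in M. \<forall>\<^sub>F j in sequentially. \<forall>n\<le>stage j. \<not> (\<forall>i<run_bound j. exc (n + i) x = 0)"
proof -
  let ?A = "\<lambda>j. \<Union>n\<le>stage j. {x \<in> Om. \<forall>i<run_bound j. exc (n + i) x = 0}"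
  have sets: "?A j \<in> sets M" for j
  proof (rule sets.finite_UN)
    show "{x \<in> Om. \<forall>i<run_bound j. exc (n + i) x = 0} \<in> sets M" for n by (rule zeros_prob(1))
  qed simp
  have bound: "measure M (?A j) \<le> dist_const * (1 / real (j + 1) ^ 2)" for j
  proof -
    have "measure M (?A j) \<le> (\<Sum>n\<le>stage j. measure M {x \<in> Om. \<forall>i<run_bound j. exc (n + i) x = 0})"
    proof (rule finite_measure_subadditive_finite)
      show "(\<lambda>n. {x \<in> Om. \<forall>i<run_bound j. exc (n + i) x = 0}) ` {..stage j} \<subseteq> sets M"
        using zeros_prob(1)[of "run_bound j"] by blast
    qed simp
    also have "\<dots> \<le> (\<Sum>n\<le>stage j. dist_const * (1/2) ^ run_bound j)" by (intro sum_mono zeros_prob(2))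
    also have "\<dots> = dist_const * (real (stage j + 1) * (1/2) ^ run_bound j)" by (simp add: algebra_simps)
    also have "\<dots> \<le> dist_const * (1 / real (j + 1) ^ 2)"
      using dist_const_ge_1 by (intro mult_left_mono run_bound_tail) auto
    finally show ?thesis .
  qed
  have "summable (\<lambda>j. inverse (real (Suc j) ^ 2))"
    using inverse_power_summable[of 2, where 'a = real] summable_Suc_iff[of "\<lambda>j. inverse (real j ^ 2)"] by simp
  then have "summable (\<lambda>j. dist_const * (1 / real (j + 1) ^ 2))"
    by (intro summable_mult) (simp add: divide_inverse)
  then have "AE x in M. \<forall>\<^sub>F j in sequentially. x \<notin> ?A j"
    by (rule eventually_not_in[where A = ?A, OF sets bound])
  moreover have "AE x in M. x \<in> Om" by (rule AE_I2) simp
  ultimately show ?thesis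
  proof eventually_elim
    case (elim x)
    from elim(1) show ?case by (rule eventually_mono) (use elim(2) in blast)
  qed
qed

section \<open>Growth of the elapsed time\<close>

text \<open>The time at which the \<open>k\<close>-th excursion starts: each earlier excursion takes its length and one more step for
  the digit \<open>1\<close> that ends it.\<close>
definition elapsed :: "nat \<Rightarrow> real \<Rightarrow> nat" where "elapsed k x = (\<Sum>i<k. exc i x + 1)"

text \<open>Subadditivity of concave powers, here by writing \<open>S powr s = S * S powr (s - 1)\<close> and replacing \<open>S\<close> in the
  decreasing second factor by the single summands.\<close>
lemma powr_sum_le:
  fixes s :: real and a :: "nat \<Rightarrow> nat"
  assumes "0 < s" "s \<le> 1"
  shows "real (\<Sum>i<k. a i + 1) powr s \<le> (\<Sum>i<k. real (a i + 1) powr s)"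
proof (cases "k = 0")
  case False
  define S where "S = real (\<Sum>i<k. a i + 1)"
  have ge: "real (a i + 1) \<le> S" if "i < k" for i
    unfolding S_def by (rule of_nat_mono, rule member_le_sum) (use that in auto)
  have "0 < S" using ge[of 0] False by auto
  then have "S powr s = S * S powr (s - 1)" by (simp add: powr_diff)
  also have "\<dots> = (\<Sum>i<k. real (a i + 1) * S powr (s - 1))"
    by (subst (1) S_def) (simp only: of_nat_sum sum_distrib_right)
  also have "\<dots> \<le> (\<Sum>i<k. real (a i + 1) * real (a i + 1) powr (s - 1))"
    using ge assms by (intro sum_mono mult_left_mono powr_mono2') auto
  also have "\<dots> = (\<Sum>i<k. real (a i + 1) powr s)"
    by (intro sum.cong) (auto simp: powr_diff)
  finally show ?thesis by (simp add: S_def)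
qed simp

text \<open>A layer-cake bound: it turns moments into the tail probabilities \<open>P(m \<le> exc i x)\<close>.\<close>
lemma powr_le_layers:
  assumes "s \<le> (1::real)"
  shows "real (a + 1) powr s \<le> (\<Sum>m\<le>a. (1 + real m) powr (s - 1))"
proof -
  have "real (a + 1) powr s = (\<Sum>m\<le>a. real (a + 1) powr (s - 1))"
    by (simp add: powr_diff add.commute)
  also have "\<dots> \<le> (\<Sum>m\<le>a. (1 + real m) powr (s - 1))"
    using assms by (intro sum_mono powr_mono2') auto
  finally show ?thesis .
qed

lemma summable_shifted_powr:
  assumes "p < (-1::real)"
  shows "summable (\<lambda>m. (1 + real m) powr p)"
  using summable_Suc_iff[of "\<lambda>m. real m powr p"] summable_real_powr_iff[of p] assms
  by (simp add: add.commute)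

text \<open>For \<open>s < 1/\<alpha>\<close> the \<open>s\<close>-th moments of the excursion lengths are bounded, since the tails are of order
  \<open>m\<close> to the power \<open>-1/\<alpha>\<close>. Weighting them by the summable sequence \<open>(1 + i) powr - t\<close> gives a series with
  finite expectation. Its almost surely finite value \<open>W\<close> bounds all partial sums at once.\<close>
lemma fractional_moment:
  assumes s: "0 < s" "s < 1 / \<alpha>" and t: "1 < t"
  shows "AE x in M. \<exists>W\<ge>0. \<forall>k. real (elapsed k x) powr s \<le> W * real k powr t"
proof -
  define c where "c i = (1 + real i) powr (- t)" for i :: nat
  define d where "d m = (1 + real m) powr (s - 1)" for m :: nat
  define w where "w i x = (\<Sum>m. ennreal (d m) * indicator {x \<in> Om. m \<le> exc i x} x)" for i x
  have s1: "s \<le> 1" using s alpha_ge_1 by (smt (verit) divide_le_eq_1)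
  have [measurable]: "{x \<in> Om. m \<le> exc i x} \<in> sets M" for m i by (rule exc_ge_prob(1))
  have [measurable]: "w i \<in> borel_measurable M" for i
    unfolding w_def by measurable
  have sd: "summable (\<lambda>m. dist_const * (1 + real m) powr (s - 1 - 1 / \<alpha>))"
    using s by (intro summable_mult summable_shifted_powr) auto
  define D where "D = (\<Sum>m. dist_const * (1 + real m) powr (s - 1 - 1 / \<alpha>))"
  have D0: "0 \<le> D" unfolding D_def using dist_const_ge_1 by (intro suminf_nonneg sd) auto
  have iw: "(\<integral>\<^sup>+x. w i x \<partial>M) \<le> ennreal D" for i
  proof -
    have "(\<integral>\<^sup>+x. w i x \<partial>M) = (\<Sum>m. \<integral>\<^sup>+x. ennreal (d m) * indicator {x \<in> Om. m \<le> exc i x} x \<partial>M)"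
      unfolding w_def by (rule nn_integral_suminf) measurable
    also have "\<dots> = (\<Sum>m. ennreal (d m) * emeasure M {x \<in> Om. m \<le> exc i x})"
      by (simp add: nn_integral_cmult_indicator)
    also have "\<dots> \<le> (\<Sum>m. ennreal (dist_const * (1 + real m) powr (s - 1 - 1 / \<alpha>)))"
    proof (intro suminf_le summableI)
      fix m
      have "d m * measure M {x \<in> Om. m \<le> exc i x} \<le> d m * (dist_const * (1 + real m) powr (- 1 / \<alpha>))"
        by (intro mult_left_mono exc_ge_prob(2)) (simp add: d_def)
      also have "\<dots> = dist_const * (1 + real m) powr (s - 1 - 1 / \<alpha>)"
        by (simp add: d_def powr_add[symmetric] mult_ac)
      finally show "ennreal (d m) * emeasure M {x \<in> Om. m \<le> exc i x}
          \<le> ennreal (dist_const * (1 + real m) powr (s - 1 - 1 / \<alpha>))"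
        by (simp add: emeasure_eq_measure d_def ennreal_mult[symmetric] ennreal_leI)
    qed
    also have "\<dots> = ennreal D"
      unfolding D_def using dist_const_ge_1 sd by (intro suminf_ennreal2) auto
    finally show ?thesis .
  qed
  have sc: "summable c" unfolding c_def using t by (intro summable_shifted_powr) auto
  have "(\<integral>\<^sup>+x. (\<Sum>i. ennreal (c i) * w i x) \<partial>M) = (\<Sum>i. ennreal (c i) * (\<integral>\<^sup>+x. w i x \<partial>M))"
    by (simp add: nn_integral_suminf nn_integral_cmult)
  also have "\<dots> \<le> (\<Sum>i. ennreal (c i) * ennreal D)"
    by (intro suminf_le summableI mult_left_mono iw) auto
  also have "\<dots> = (\<Sum>i. ennreal (c i * D))"
    using D0 by (simp add: c_def ennreal_mult)
  also have "\<dots> = ennreal (\<Sum>i. c i * D)"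
    using D0 by (intro suminf_ennreal2 summable_mult2 sc) (simp add: c_def)
  finally have "(\<integral>\<^sup>+x. (\<Sum>i. ennreal (c i) * w i x) \<partial>M) \<noteq> \<infinity>"
    by (auto simp: top_unique)
  then have "AE x in M. (\<Sum>i. ennreal (c i) * w i x) \<noteq> \<infinity>"
    by (intro nn_integral_noteq_infinite) auto
  moreover have "AE x in M. x \<in> Om" by (rule AE_I2) simp
  ultimately show ?thesis
  proof eventually_elim
    case (elim x)
    then obtain W where W: "0 \<le> W" "(\<Sum>i. ennreal (c i) * w i x) = ennreal W"
      by (metis ennreal_cases infinity_ennreal_def)
    have wge: "ennreal (real (exc i x + 1) powr s) \<le> w i x" for i
    proof -
      have "ennreal (real (exc i x + 1) powr s) \<le> ennreal (\<Sum>m\<le>exc i x. d m)"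
        unfolding d_def by (intro ennreal_leI powr_le_layers s1)
      also have "\<dots> = (\<Sum>m\<le>exc i x. ennreal (d m) * indicator {x \<in> Om. m \<le> exc i x} x)"
        using elim(2) by (simp add: sum_ennreal d_def indicator_def)
      also have "\<dots> \<le> w i x"
        unfolding w_def by (intro sum_le_suminf summableI) auto
      finally show ?thesis .
    qed
    have "real (elapsed k x) powr s \<le> W * real k powr t" for k
    proof (cases "k = 0")
      case False
      have "ennreal (\<Sum>i<k. real k powr (- t) * real (exc i x + 1) powr s)
          = (\<Sum>i<k. ennreal (real k powr (- t)) * ennreal (real (exc i x + 1) powr s))"
        by (simp add: ennreal_mult[symmetric])
      also have "\<dots> \<le> (\<Sum>i<k. ennreal (c i) * w i x)"
        using t by (intro sum_mono mult_mono wge ennreal_leI) (auto simp: c_def intro!: powr_mono2')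
      also have "\<dots> \<le> ennreal W"
        unfolding W(2)[symmetric] by (intro sum_le_suminf summableI) auto
      finally have "(\<Sum>i<k. real k powr (- t) * real (exc i x + 1) powr s) \<le> W"
        using W(1) by (simp add: ennreal_le_iff)
      then have "real k powr (- t) * (\<Sum>i<k. real (exc i x + 1) powr s) \<le> W"
        by (simp add: sum_distrib_left)
      then have "(\<Sum>i<k. real (exc i x + 1) powr s) \<le> W * real k powr t"
        using False by (simp add: powr_minus field_simps)
      with powr_sum_le[OF s(1) s1, of "\<lambda>i. exc i x" k] show ?thesis by (simp add: elapsed_def)
    qed (simp add: elapsed_def)
    with W(1) show ?case by blast
  qed
qed

lemma elapsed_growth:
  assumes "\<beta> > \<alpha>"
  shows "AE x in M. \<exists>B. \<forall>k. real (elapsed k x) \<le> B * real k powr \<beta>"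
proof -
  \<comment> \<open>The geometric mean leaves room on both sides: \<open>s < 1/\<alpha>\<close> for the moment, and \<open>t = \<beta> * s > 1\<close> for the weights.\<close>
  define s where "s = 1 / sqrt (\<alpha> * \<beta>)"
  have pos: "0 < \<alpha>" "0 < \<beta>" using alpha_ge_1 assms by auto
  have "sqrt (\<alpha> * \<alpha>) < sqrt (\<alpha> * \<beta>)" "sqrt (\<alpha> * \<beta>) < sqrt (\<beta> * \<beta>)"
    using pos assms by (intro real_sqrt_less_mono mult_strict_left_mono mult_strict_right_mono; simp)+
  then have sq: "\<alpha> < sqrt (\<alpha> * \<beta>)" "sqrt (\<alpha> * \<beta>) < \<beta>" "0 < sqrt (\<alpha> * \<beta>)" using pos by auto
  have s: "0 < s" "s < 1 / \<alpha>" "1 < \<beta> * s"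
    using sq pos by (auto simp: s_def field_simps)
  from fractional_moment[OF s] show ?thesis
  proof eventually_elim
    case (elim x)
    then obtain W where W: "W \<ge> 0" "\<And>k. real (elapsed k x) powr s \<le> W * real k powr (\<beta> * s)" by blast
    have "real (elapsed k x) \<le> W powr (1 / s) * real k powr \<beta>" for k
    proof -
      have "real (elapsed k x) = (real (elapsed k x) powr s) powr (1 / s)" using s by (simp add: powr_powr)
      also have "\<dots> \<le> (W * real k powr (\<beta> * s)) powr (1 / s)"
        using s W by (intro powr_mono2) auto
      also have "\<dots> = W powr (1 / s) * real k powr \<beta>"
        using s W by (simp add: powr_mult powr_powr)
      finally show ?thesis .
    qed
    then show ?case by blast
  qed
qed

section \<open>Digits read off from excursions\<close>

lemma elapsed_Suc: "elapsed (Suc i) x = elapsed i x + Suc (exc i x)"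
  by (simp add: elapsed_def)

lemma elapsed_mono: "i \<le> k \<Longrightarrow> elapsed i x \<le> elapsed k x"
  unfolding elapsed_def by (rule sum_mono2) auto

lemma le_elapsed: "k \<le> elapsed k x"
  by (induction k) (auto simp: elapsed_Suc elapsed_def)

lemma jump_pow_eq: "(jump ^^ i) x = (f ^^ elapsed i x) x"
proof (induction i)
  case (Suc i)
  have "(jump ^^ Suc i) x = (f ^^ Suc (exc i x)) ((jump ^^ i) x)" by (simp add: jump_def exc_def)
  also have "\<dots> = (f ^^ (Suc (exc i x) + elapsed i x)) x" unfolding Suc funpow_add by simp
  finally show ?case by (simp only: elapsed_Suc add.commute)
qed (simp add: elapsed_def)

text \<open>After \<open>b\<close> steps of an excursion of length \<open>a\<close> the orbit is in the fundamental interval of index \<open>a - b\<close>,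
  which lies in \<open>[0, 1/2)\<close> iff \<open>b < a\<close>.\<close>
lemma digit_in_excursion:
  assumes x: "x \<in> Om" and b: "b \<le> exc i x"
  shows "digit \<alpha> (Suc (elapsed i x + b)) x = (if b < exc i x then 0 else 1)"
proof -
  define y where "y = (jump ^^ i) x"
  have y: "0 < y" "y < 1" using Om_pos jump_pow_Om[OF x] by (auto simp: y_def)
  have e: "exc i x = entry_time y" by (simp add: y_def exc_def)
  have "(f ^^ (elapsed i x + b)) x = (f ^^ b) y"
    by (simp add: y_def jump_pow_eq funpow_add add.commute[of "elapsed i x"])
  also have "\<dots> = branch1 (entry_time y - b) (jump y)"
    using f_pow_branch1[OF branch1_entry_jump(2)[OF y], of b "entry_time y"] branch1_entry_jump(1)[OF y] b e by simp
  finally have pt: "(f ^^ (elapsed i x + b)) x = branch1 (entry_time y - b) (jump y)" .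
  show ?thesis
  proof (cases "b < entry_time y")
    case True
    then have "z (entry_time y - b) \<le> z 1" by (intro z_antimono) auto
    then have "branch1 (entry_time y - b) (jump y) \<in> {0..<1/2}"
      using branch1_in[OF branch1_entry_jump(2)[OF y], of "entry_time y - b"] z_pos[of "Suc (entry_time y - b)"] by simp
    then show ?thesis using True by (simp add: digit_def pt e)
  next
    case False
    then have "1/2 \<le> branch1 (entry_time y - b) (jump y)"
      using branch1_in(1)[OF branch1_entry_jump(2)[OF y], of 0] by simp
    then show ?thesis using False by (simp add: digit_def pt e)
  qed
qed

lemma excursion_le_zero_run:
  assumes "x \<in> Om" "i < k" "elapsed k x \<le> n"
  shows "exc i x \<le> run_length \<alpha> 0 n x"
proof (rule run_length_ge)
  show "elapsed i x + exc i x \<le> n" using elapsed_mono[of "Suc i" k x] assms by (simp add: elapsed_Suc)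
  show "digit \<alpha> (Suc (elapsed i x + m)) x = 0" if "m < exc i x" for m
    using digit_in_excursion[OF assms(1), of m i] that by simp
qed

lemma zero_excursions_le_one_run:
  assumes "x \<in> Om" "\<And>i. i < j \<Longrightarrow> exc (q + i) x = 0" "q + j \<le> k" "elapsed k x \<le> n"
  shows "j \<le> run_length \<alpha> 1 n x"
proof (rule run_length_ge)
  have elapsed: "elapsed (q + m) x = elapsed q x + m" if "m \<le> j" for m
    using that by (induction m) (auto simp: elapsed_Suc assms(2))
  show "elapsed q x + j \<le> n" using elapsed[of j] elapsed_mono[OF assms(3), of x] assms(4) by simp
  show "digit \<alpha> (Suc (elapsed q x + m)) x = 1" if "m < j" for m
    using digit_in_excursion[OF assms(1), of 0 "q + m"] assms(2)[OF that] elapsed[of m] that by simp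
qed

text \<open>A run of digits \<open>1\<close> starts with the last digit of some excursion \<open>q\<close>, and every later digit of the run is
  a whole excursion of length \<open>0\<close>. So a run of more than \<open>l\<close> digits yields \<open>l\<close> zero excursions from index
  \<open>Suc q\<close> on, and \<open>Suc q\<close> is in range because the run starts before time \<open>n\<close>.\<close>
lemma one_run_le:
  assumes x: "x \<in> Om" and n: "n < elapsed k x"
    and no_run: "\<And>q. q \<le> k \<Longrightarrow> \<not> (\<forall>i<l. exc (q + i) x = 0)"
  shows "run_length \<alpha> 1 n x \<le> l"
proof (rule ccontr)
  assume "\<not> run_length \<alpha> 1 n x \<le> l"
  then have r: "l < run_length \<alpha> 1 n x" by simp
  obtain p where p: "p + run_length \<alpha> 1 n x \<le> n"
      "\<And>m. m < run_length \<alpha> 1 n x \<Longrightarrow> digit \<alpha> (Suc (p + m)) x = 1"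
    using run_length_attained[where \<alpha> = \<alpha> and j = 1 and n = n and x = x] by metis
  \<comment> \<open>The excursion in which the run starts.\<close>
  define q where "q = (LEAST q. p < elapsed (Suc q) x)"
  have q1: "p < elapsed (Suc q) x"
    unfolding q_def by (rule LeastI[of _ p]) (use le_elapsed[of "Suc p" x] in simp)
  have q2: "elapsed q x \<le> p"
  proof (cases q)
    case (Suc q')
    then have "\<not> p < elapsed (Suc q') x" unfolding q_def by (intro not_less_Least) simp
    then show ?thesis using Suc by simp
  qed (simp add: elapsed_def)
  have qe: "elapsed (Suc q) x = p + 1"
  proof (rule ccontr)
    assume "elapsed (Suc q) x \<noteq> p + 1"
    then have "p - elapsed q x < exc q x" using q1 q2 by (simp add: elapsed_Suc)
    then have "digit \<alpha> (Suc (elapsed q x + (p - elapsed q x))) x = 0"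
      using digit_in_excursion[OF x, of "p - elapsed q x" q] by simp
    then show False using p(2)[of 0] q2 r by simp
  qed
  have run: "elapsed (Suc q + m) x = p + 1 + m" if "m \<le> l" for m
    using that
  proof (induction m)
    case (Suc m)
    then have IH: "elapsed (Suc q + m) x = p + 1 + m" by simp
    have "digit \<alpha> (Suc (p + Suc m)) x = 1" using Suc.prems r by (intro p(2)) simp
    then have "exc (Suc q + m) x = 0"
      using digit_in_excursion[OF x, of 0 "Suc q + m"] IH by (cases "exc (Suc q + m) x = 0") auto
    then show ?case using IH by (simp add: elapsed_Suc)
  qed (simp add: qe)
  have "exc (Suc q + m) x = 0" if "m < l" for m
    using run[of m] run[of "Suc m"] that by (simp add: elapsed_Suc)
  moreover have "Suc q \<le> k"
  proof (rule ccontr)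
    assume "\<not> Suc q \<le> k"
    then have "elapsed k x \<le> elapsed (Suc q) x" by (intro elapsed_mono) simp
    then show False using n qe p(1) r by simp
  qed
  ultimately show False using no_run by blast
qed

section \<open>The two limits\<close>

lemma filterlim_nat_floor_log:
  assumes "\<gamma> > 0"
  shows "filterlim (\<lambda>n::nat. nat \<lfloor>log 2 (real n) / \<gamma>\<rfloor>) sequentially sequentially"
  unfolding filterlim_at_top
proof
  fix Z :: nat
  have "filterlim (\<lambda>n::nat. log 2 (real n) / \<gamma>) at_top sequentially"
    using assms by real_asymp
  then have "\<forall>\<^sub>F n in sequentially. real Z \<le> log 2 (real n) / \<gamma>" by (simp add: filterlim_at_top)
  then show "\<forall>\<^sub>F n in sequentially. Z \<le> nat \<lfloor>log 2 (real n) / \<gamma>\<rfloor>"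
    by eventually_elim (rule le_nat_floor)
qed

lemma powr_nat_floor_log_le:
  assumes "\<gamma> > 0" "n \<ge> 1"
  shows "2 powr (\<gamma> * real (nat \<lfloor>log 2 (real n) / \<gamma>\<rfloor>)) \<le> real n"
proof -
  define j where "j = nat \<lfloor>log 2 (real n) / \<gamma>\<rfloor>"
  have "real j \<le> log 2 (real n) / \<gamma>"
    unfolding j_def using assms by (intro of_nat_floor) simp
  then have "\<gamma> * real j \<le> log 2 (real n)"
    using assms by (simp add: pos_le_divide_eq mult.commute)
  then have "2 powr (\<gamma> * real j) \<le> 2 powr log 2 (real n)"
    by (intro powr_mono) auto
  then show ?thesis using assms by (simp add: j_def)
qed

lemma ex_reciprocal_greater:
  assumes "0 < (c::real)" "a < 1 / c"
  shows "\<exists>\<gamma>>c. a < 1 / \<gamma>"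
proof -
  have "((\<lambda>\<gamma>. 1 / \<gamma>) \<longlongrightarrow> 1 / c) (at_right c)"
    using assms by (intro tendsto_intros) auto
  then have "\<forall>\<^sub>F \<gamma> in at_right c. a < 1 / \<gamma>" using assms(2) by (rule order_tendstoD)
  moreover have "\<forall>\<^sub>F \<gamma> in at_right c. c < \<gamma>" by (rule eventually_at_right_less)
  ultimately have "\<forall>\<^sub>F \<gamma> in at_right c. c < \<gamma> \<and> a < 1 / \<gamma>" by eventually_elim simp
  then have "\<exists>\<gamma>. c < \<gamma> \<and> a < 1 / \<gamma>"
    by (rule eventually_happens'[OF trivial_limit_at_right_real])
  then show ?thesis by blast
qed

lemma poly_le_exp:
  assumes "\<beta> > 0" "\<delta> > 0"
  shows "\<forall>\<^sub>F j in sequentially. B * (real j + 2) powr \<beta> \<le> 2 powr (\<delta> * real j)"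
proof -
  have "((\<lambda>j::nat. B * ((real j + 2) powr \<beta> / 2 powr (\<delta> * real j))) \<longlongrightarrow> B * 0) sequentially"
  proof (intro tendsto_mult tendsto_const)
    show "((\<lambda>j::nat. (real j + 2) powr \<beta> / 2 powr (\<delta> * real j)) \<longlongrightarrow> 0) sequentially"
      using assms by real_asymp
  qed
  then have "\<forall>\<^sub>F j in sequentially. B * ((real j + 2) powr \<beta> / 2 powr (\<delta> * real j)) < 1"
    by (intro order_tendstoD(2)[where a = 1]) auto
  then show ?thesis by eventually_elim (simp add: field_simps)
qed

text \<open>The polynomial bound on \<open>elapsed\<close> transferred to the exponential scale: if the number \<open>k j\<close> of excursions
  grows like \<open>2 powr (\<tau> * j)\<close> up to polynomial factors, they take time at most \<open>2 powr (\<gamma> * j)\<close> for any \<open>\<gamma> > \<alpha> * \<tau>\<close>.\<close>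
lemma elapsed_exponential_growth:
  assumes growth: "\<And>q::nat. \<exists>B. \<forall>k. real (elapsed k x) \<le> B * real k powr (\<alpha> + 1 / (real q + 1))"
    and k: "\<And>j. real (k j) \<le> (real j + 2) ^ 2 * 2 powr (\<tau> * real j)"
    and \<tau>: "\<tau> > 0" "\<gamma> > \<alpha> * \<tau>"
  shows "\<forall>\<^sub>F j in sequentially. real (elapsed (k j) x) \<le> 2 powr (\<gamma> * real j)"
proof -
  have "0 < \<gamma> / \<tau> - \<alpha>" using \<tau> by (simp add: field_simps)
  then obtain q :: nat where "1 / (real q + 1) < \<gamma> / \<tau> - \<alpha>"
    using reals_Archimedean by (metis inverse_eq_divide of_nat_Suc add.commute)
  then have q: "(\<alpha> + 1 / (real q + 1)) * \<tau> < \<gamma>" using \<tau> by (simp add: field_simps)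
  define \<beta> where "\<beta> = \<alpha> + 1 / (real q + 1)"
  have \<beta>: "\<beta> > 0" using alpha_ge_1 by (simp add: \<beta>_def add_pos_pos)
  obtain B where B: "\<And>k. real (elapsed k x) \<le> B * real k powr \<beta>"
    using growth[of q] unfolding \<beta>_def by blast
  have "\<forall>\<^sub>F j in sequentially. \<bar>B\<bar> * (real j + 2) powr (2 * \<beta>) \<le> 2 powr ((\<gamma> - \<beta> * \<tau>) * real j)"
    using \<beta> q by (intro poly_le_exp) (auto simp: \<beta>_def)
  then show ?thesis
  proof eventually_elim
    case (elim j)
    have "real (elapsed (k j) x) \<le> B * real (k j) powr \<beta>" by (rule B)
    also have "\<dots> \<le> \<bar>B\<bar> * real (k j) powr \<beta>" by (intro mult_right_mono) auto
    also have "\<dots> \<le> \<bar>B\<bar> * ((real j + 2) ^ 2 * 2 powr (\<tau> * real j)) powr \<beta>"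
      using \<beta> k by (intro mult_left_mono powr_mono2) auto
    also have "\<dots> = \<bar>B\<bar> * (real j + 2) powr (2 * \<beta>) * 2 powr (\<beta> * \<tau> * real j)"
    proof -
      have "(real j + 2) ^ 2 = (real j + 2) powr 2" by simp
      then have "((real j + 2) ^ 2) powr \<beta> = (real j + 2) powr (2 * \<beta>)"
        by (simp only: powr_powr)
      moreover have "(2 powr (\<tau> * real j)) powr \<beta> = 2 powr (\<beta> * \<tau> * real j)"
        by (simp only: powr_powr mult_ac)
      ultimately show ?thesis by (simp only: powr_mult mult.assoc)
    qed
    also have "\<dots> \<le> 2 powr ((\<gamma> - \<beta> * \<tau>) * real j) * 2 powr (\<beta> * \<tau> * real j)"
      by (intro mult_right_mono elim) auto
    also have "\<dots> = 2 powr (\<gamma> * real j)" by (simp add: powr_add[symmetric] algebra_simps)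
    finally show ?case .
  qed
qed

lemma stage_le_poly_exp: "real (stage j) + 1 \<le> (real j + 2) * 2 powr (real j / \<alpha>)"
proof -
  have "1 \<le> 2 powr (real j / \<alpha>)" using alpha_ge_1 by (simp add: ge_one_powr_ge_zero)
  then show ?thesis using stage_le[of j] by (simp add: algebra_simps)
qed

lemma run_bound_le: "real (run_bound j) \<le> real j / \<alpha> + 3 * log 2 (real j + 2) + 1"
proof -
  let ?y = "real (stage j + 1) * real (j + 1) ^ 2"
  have "1 * 1 \<le> ?y" by (intro mult_mono) auto
  then have y: "1 \<le> ?y" by simp
  have "?y \<le> ((real j + 2) * 2 powr (real j / \<alpha>)) * (real j + 2) ^ 2"
    using stage_le_poly_exp[of j] by (intro mult_mono power_mono) auto
  also have "\<dots> = (real j + 2) ^ 3 * 2 powr (real j / \<alpha>)"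
    by (simp add: power2_eq_square power3_eq_cube)
  finally have "log 2 ?y \<le> log 2 ((real j + 2) ^ 3 * 2 powr (real j / \<alpha>))"
    using y by simp
  also have "\<dots> = 3 * log 2 (real j + 2) + real j / \<alpha>"
    by (subst log_mult) (auto simp: log_nat_power)
  finally have "log 2 ?y \<le> 3 * log 2 (real j + 2) + real j / \<alpha>" .
  moreover have "real (run_bound j) \<le> log 2 ?y + 1"
  proof -
    have "0 \<le> log 2 ?y" using y by simp
    then show ?thesis unfolding run_bound_def by linarith
  qed
  ultimately show ?thesis by linarith
qed

text \<open>For the lower bound, choose \<open>j = \<lfloor>log 2 n / \<gamma>\<rfloor>\<close> with \<open>\<gamma> > \<alpha>\<close>: the first \<open>j\<^sup>2\<close>\<open>2\<^sup>j\<close> excursions are completed by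
  time \<open>n\<close> and contain \<open>j\<close> consecutive digits \<open>1\<close>. For the upper bound, choose \<open>j\<close> with \<open>n < 2\<^sup>j\<close>: one of the
  first \<open>stage j\<close> excursions is longer than \<open>n\<close>, so only excursions before index \<open>stage j\<close> start by time \<open>n\<close>,
  and \<open>run_bound j\<close> limits the runs.\<close>
lemma one_run_limit:
  assumes x: "x \<in> Om"
    and long: "\<forall>\<^sub>F j in sequentially. \<exists>i<stage j. 2 ^ j \<le> exc i x"
    and zeros: "\<forall>\<^sub>F j in sequentially. \<exists>n. n + j \<le> j * j * 2 ^ j \<and> (\<forall>i<j. exc (n + i) x = 0)"
    and no_zeros: "\<forall>\<^sub>F j in sequentially. \<forall>n\<le>stage j. \<not> (\<forall>i<run_bound j. exc (n + i) x = 0)"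
    and growth: "\<And>q::nat. \<exists>B. \<forall>k. real (elapsed k x) \<le> B * real k powr (\<alpha> + 1 / (real q + 1))"
  shows "(\<lambda>n. real (run_length \<alpha> 1 n x) / log 2 (real n)) \<longlonglongrightarrow> 1 / \<alpha>"
proof (rule order_tendstoI)
  have \<alpha>: "0 < \<alpha>" using alpha_ge_1 by simp
  fix a assume "a < 1 / \<alpha>"
  with \<alpha> obtain \<gamma> where \<gamma>: "\<gamma> > \<alpha>" "a < 1 / \<gamma>" using ex_reciprocal_greater by blast
  then have \<gamma>0: "\<gamma> > 0" using \<alpha> by simp
  have kb: "real (j * j * 2 ^ j) \<le> (real j + 2) ^ 2 * 2 powr (1 * real j)" for j
    by (simp add: powr_realpow power2_eq_square mult_right_mono algebra_simps)
  have "\<forall>\<^sub>F j in sequentially. real (elapsed (j * j * 2 ^ j) x) \<le> 2 powr (\<gamma> * real j)"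
    using \<gamma> by (intro elapsed_exponential_growth[OF growth kb]) auto
  with zeros have "\<forall>\<^sub>F j in sequentially. real (elapsed (j * j * 2 ^ j) x) \<le> 2 powr (\<gamma> * real j) \<and>
      (\<exists>n. n + j \<le> j * j * 2 ^ j \<and> (\<forall>i<j. exc (n + i) x = 0))"
    by eventually_elim simp
  from eventually_compose_filterlim[OF this filterlim_nat_floor_log[OF \<gamma>0]]
  have "\<forall>\<^sub>F n in sequentially. nat \<lfloor>log 2 (real n) / \<gamma>\<rfloor> \<le> run_length \<alpha> 1 n x"
    using eventually_ge_at_top[of 1]
  proof eventually_elim
    case (elim n)
    let ?j = "nat \<lfloor>log 2 (real n) / \<gamma>\<rfloor>"
    from elim(1) obtain q where q: "q + ?j \<le> ?j * ?j * 2 ^ ?j" "\<And>i. i < ?j \<Longrightarrow> exc (q + i) x = 0"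
      by blast
    have "real (elapsed (?j * ?j * 2 ^ ?j) x) \<le> real n"
      using elim powr_nat_floor_log_le[OF \<gamma>0, of n] by linarith
    then have "elapsed (?j * ?j * 2 ^ ?j) x \<le> n" by simp
    with zero_excursions_le_one_run[OF x q(2) q(1)] show ?case by blast
  qed
  moreover have "(\<lambda>n. (log 2 (real n) / \<gamma> - 1) / log 2 (real n)) \<longlonglongrightarrow> 1 / \<gamma>"
    using \<gamma>0 by (real_asymp simp: field_simps)
  then have "\<forall>\<^sub>F n in sequentially. a < (log 2 (real n) / \<gamma> - 1) / log 2 (real n)"
    using \<gamma>(2) by (rule order_tendstoD)
  ultimately show "\<forall>\<^sub>F n in sequentially. a < real (run_length \<alpha> 1 n x) / log 2 (real n)"
    using eventually_gt_at_top[of 1]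
  proof eventually_elim
    case (elim n)
    have "log 2 (real n) / \<gamma> - 1 \<le> real (run_length \<alpha> 1 n x)" using elim(1) by linarith
    then have "(log 2 (real n) / \<gamma> - 1) / log 2 (real n) \<le> real (run_length \<alpha> 1 n x) / log 2 (real n)"
      using elim(3) by (intro divide_right_mono) auto
    then show ?case using elim(2) by linarith
  qed
next
  have \<alpha>: "0 < \<alpha>" using alpha_ge_1 by simp
  fix a assume a: "1 / \<alpha> < a"
  have lim: "filterlim (\<lambda>n. Suc (nat \<lfloor>log 2 (real n)\<rfloor>)) sequentially sequentially"
    using filterlim_compose[OF filterlim_Suc filterlim_nat_floor_log[of 1]] by simp
  from long no_zeros have "\<forall>\<^sub>F j in sequentially. (\<exists>i<stage j. 2 ^ j \<le> exc i x) \<and>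
      (\<forall>n\<le>stage j. \<not> (\<forall>i<run_bound j. exc (n + i) x = 0))" by eventually_elim simp
  from eventually_compose_filterlim[OF this lim]
  have "\<forall>\<^sub>F n in sequentially. run_length \<alpha> 1 n x \<le> run_bound (Suc (nat \<lfloor>log 2 (real n)\<rfloor>))"
    using eventually_ge_at_top[of 1]
  proof eventually_elim
    case (elim n)
    let ?j = "Suc (nat \<lfloor>log 2 (real n)\<rfloor>)"
    from elim(1) obtain i where i: "i < stage ?j" "2 ^ ?j \<le> exc i x" by blast
    have "real n = 2 powr log 2 (real n)" using elim(2) by simp
    also have "\<dots> < 2 powr real ?j" by (intro powr_less_mono) (linarith, simp)
    also have "\<dots> = real (2 ^ ?j)" by (simp only: powr_realpow of_nat_power of_nat_numeral zero_less_numeral)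
    finally have "n < 2 ^ ?j" by (simp only: of_nat_less_iff)
    also have "\<dots> \<le> elapsed (Suc i) x" using i(2) by (simp add: elapsed_Suc)
    also have "\<dots> \<le> elapsed (stage ?j) x" using i(1) by (intro elapsed_mono) simp
    finally show ?case using elim(1) by (intro one_run_le[OF x]) auto
  qed
  moreover have "(\<lambda>n. ((log 2 (real n) + 1) / \<alpha> + 3 * log 2 (log 2 (real n) + 3) + 1) / log 2 (real n))
      \<longlonglongrightarrow> 1 / \<alpha>"
    using \<alpha> by (real_asymp simp: field_simps)
  then have "\<forall>\<^sub>F n in sequentially.
      ((log 2 (real n) + 1) / \<alpha> + 3 * log 2 (log 2 (real n) + 3) + 1) / log 2 (real n) < a"
    using a by (rule order_tendstoD)
  ultimately show "\<forall>\<^sub>F n in sequentially. real (run_length \<alpha> 1 n x) / log 2 (real n) < a"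
    using eventually_gt_at_top[of 1]
  proof eventually_elim
    case (elim n)
    let ?j = "Suc (nat \<lfloor>log 2 (real n)\<rfloor>)"
    have l: "0 < log 2 (real n)" using elim(3) by simp
    then have j: "real ?j \<le> log 2 (real n) + 1" by linarith
    then have lj: "log 2 (real ?j + 2) \<le> log 2 (log 2 (real n) + 3)"
      by (intro log_mono) linarith+
    have "real (run_length \<alpha> 1 n x) \<le> real ?j / \<alpha> + 3 * log 2 (real ?j + 2) + 1"
      using elim(1) run_bound_le[of ?j] by linarith
    also have "\<dots> \<le> (log 2 (real n) + 1) / \<alpha> + 3 * log 2 (log 2 (real n) + 3) + 1"
    proof (intro add_mono order.refl)
      show "real ?j / \<alpha> \<le> (log 2 (real n) + 1) / \<alpha>" by (rule divide_right_mono[OF j]) (use \<alpha> in simp)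
      show "3 * log 2 (real ?j + 2) \<le> 3 * log 2 (log 2 (real n) + 3)" using lj by linarith
    qed
    finally have "real (run_length \<alpha> 1 n x) / log 2 (real n)
        \<le> ((log 2 (real n) + 1) / \<alpha> + 3 * log 2 (log 2 (real n) + 3) + 1) / log 2 (real n)"
      using l by (intro divide_right_mono) auto
    then show ?case using elim(2) by linarith
  qed
qed

text \<open>A run is never longer than \<open>n\<close>. For the lower bound, choose \<open>j = \<lfloor>log 2 n / \<gamma>\<rfloor>\<close> with \<open>\<gamma> > 1\<close>: the first \<open>stage j\<close>
  excursions are completed by time \<open>n\<close>, and one of them has length at least \<open>2\<^sup>j\<close>.\<close>
lemma zero_run_limit:
  assumes x: "x \<in> Om"
    and long: "\<forall>\<^sub>F j in sequentially. \<exists>i<stage j. 2 ^ j \<le> exc i x"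
    and growth: "\<And>q::nat. \<exists>B. \<forall>k. real (elapsed k x) \<le> B * real k powr (\<alpha> + 1 / (real q + 1))"
  shows "(\<lambda>n. ln (real (run_length \<alpha> 0 n x)) / ln (real n)) \<longlonglongrightarrow> 1"
proof (rule order_tendstoI)
  have \<alpha>: "0 < \<alpha>" using alpha_ge_1 by simp
  fix a :: real assume "a < 1"
  then obtain \<gamma> where \<gamma>: "\<gamma> > 1" "a < 1 / \<gamma>" using ex_reciprocal_greater[of 1 a] by auto
  then have \<gamma>0: "\<gamma> > 0" by simp
  have kb: "real (stage j) \<le> (real j + 2) ^ 2 * 2 powr (1 / \<alpha> * real j)" for j
  proof -
    have "(real j + 2) * 2 powr (real j / \<alpha>) \<le> (real j + 2) ^ 2 * 2 powr (real j / \<alpha>)"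
      by (intro mult_right_mono) (auto simp: power2_eq_square)
    with stage_le_poly_exp[of j] have "real (stage j) \<le> (real j + 2) ^ 2 * 2 powr (real j / \<alpha>)" by linarith
    then show ?thesis by simp
  qed
  have "\<forall>\<^sub>F j in sequentially. real (elapsed (stage j) x) \<le> 2 powr (\<gamma> * real j)"
    using \<gamma> \<alpha> by (intro elapsed_exponential_growth[OF growth kb]) auto
  with long have "\<forall>\<^sub>F j in sequentially. real (elapsed (stage j) x) \<le> 2 powr (\<gamma> * real j) \<and>
      (\<exists>i<stage j. 2 ^ j \<le> exc i x)"
    by eventually_elim simp
  from eventually_compose_filterlim[OF this filterlim_nat_floor_log[OF \<gamma>0]]
  have "\<forall>\<^sub>F n in sequentially. 2 ^ nat \<lfloor>log 2 (real n) / \<gamma>\<rfloor> \<le> run_length \<alpha> 0 n x"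
    using eventually_ge_at_top[of 1]
  proof eventually_elim
    case (elim n)
    let ?j = "nat \<lfloor>log 2 (real n) / \<gamma>\<rfloor>"
    from elim(1) obtain i where i: "i < stage ?j" "2 ^ ?j \<le> exc i x" by blast
    have "real (elapsed (stage ?j) x) \<le> real n"
      using elim powr_nat_floor_log_le[OF \<gamma>0, of n] by linarith
    then have "exc i x \<le> run_length \<alpha> 0 n x" using i(1) by (intro excursion_le_zero_run[OF x]) auto
    with i(2) show ?case by simp
  qed
  moreover have "(\<lambda>n. ((log 2 (real n) / \<gamma> - 1) * ln 2) / ln (real n)) \<longlonglongrightarrow> 1 / \<gamma>"
    using \<gamma>0 by (real_asymp simp: field_simps)
  then have "\<forall>\<^sub>F n in sequentially. a < ((log 2 (real n) / \<gamma> - 1) * ln 2) / ln (real n)"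
    using \<gamma>(2) by (rule order_tendstoD)
  ultimately show "\<forall>\<^sub>F n in sequentially. a < ln (real (run_length \<alpha> 0 n x)) / ln (real n)"
    using eventually_gt_at_top[of 1]
  proof eventually_elim
    case (elim n)
    let ?j = "nat \<lfloor>log 2 (real n) / \<gamma>\<rfloor>"
    have "(log 2 (real n) / \<gamma> - 1) * ln 2 \<le> real ?j * ln 2"
      by (intro mult_right_mono) (linarith, simp)
    also have "\<dots> = ln (real (2 ^ ?j))" by (simp add: ln_realpow)
    also have "\<dots> \<le> ln (real (run_length \<alpha> 0 n x))"
      using elim(1) by (intro ln_mono) (auto intro: less_le_trans[of _ "2 ^ ?j"] simp del: of_nat_power)
    finally have "((log 2 (real n) / \<gamma> - 1) * ln 2) / ln (real n)
        \<le> ln (real (run_length \<alpha> 0 n x)) / ln (real n)"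
      using elim(3) by (intro divide_right_mono) auto
    then show ?case using elim(2) by linarith
  qed
next
  fix a :: real assume a: "1 < a"
  show "\<forall>\<^sub>F n in sequentially. ln (real (run_length \<alpha> 0 n x)) / ln (real n) < a"
    using eventually_gt_at_top[of 1]
  proof eventually_elim
    case (elim n)
    have "ln (real (run_length \<alpha> 0 n x)) \<le> ln (real n)"
    proof (cases "run_length \<alpha> 0 n x = 0")
      case False
      then show ?thesis using run_length_le[of \<alpha> 0 n x] by simp
    qed (use elim in simp)
    then have "ln (real (run_length \<alpha> 0 n x)) / ln (real n) \<le> 1" using elim by simp
    then show ?case using a by linarith
  qed
qed

text \<open>It suffices to bound \<open>elapsed\<close> for the countably many exponents \<open>\<alpha> + 1/(q + 1)\<close>, so that the exceptional null
  sets can be united.\<close>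
lemma run_length_limits:
  "AE x in lebesgue_on circle.
           ((\<lambda>n. real (run_length \<alpha> 1 n x) / log 2 (real n)) \<longlonglongrightarrow> 1 / \<alpha>) \<and>
           ((\<lambda>n. ln (real (run_length \<alpha> 0 n x)) / ln (real n)) \<longlonglongrightarrow> 1)"
  (is "AE x in _. ?P x")
proof -
  have "AE x in M. \<forall>q::nat. \<exists>B. \<forall>k. real (elapsed k x) \<le> B * real k powr (\<alpha> + 1 / (real q + 1))"
    unfolding AE_all_countable by (intro allI elapsed_growth) simp
  moreover have "AE x in M. x \<in> Om" by (rule AE_I2) simp
  ultimately have "AE x in M. ?P x"
    using long_excursion_early long_zero_run_early no_longer_zero_run
  proof eventually_elim
    case (elim x)
    show ?case
      using one_run_limit[OF elim(2-5)] zero_run_limit[OF elim(2,3)] elim(1) by blast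
  qed
  then have "AE x in lborel. x \<in> Om \<longrightarrow> ?P x"
    unfolding M_def using Om_borel by (subst (asm) AE_restrict_space_iff) simp_all
  moreover have "AE x in lborel. x \<notin> circle - Om"
    using countable_circle_minus_Om countable_imp_null_set_lborel AE_not_in by blast
  ultimately have "AE x in lborel. x \<in> circle \<longrightarrow> ?P x" by eventually_elim blast
  then have "AE x in lebesgue. x \<in> circle \<longrightarrow> ?P x" by (rule AE_completion)
  moreover have "circle \<in> sets lebesgue" by (simp add: circle_def)
  ultimately show ?thesis by (subst AE_restrict_space_iff) simp_all
qed

end

theorem theorem2p27:
  fixes \<alpha> :: real
  assumes "\<alpha> \<ge> 1"
  shows "AE x in lebesgue_on circle.
           ((\<lambda>n. real (run_length \<alpha> 1 n x) / log 2 (real n)) \<longlonglongrightarrow> 1 / \<alpha>) \<and>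
           ((\<lambda>n. ln (real (run_length \<alpha> 0 n x)) / ln (real n)) \<longlonglongrightarrow> 1)"
proof -
  interpret intermittent \<alpha>
    by unfold_locales (rule assms)
  show ?thesis by (rule run_length_limits)
qed

end
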